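(* Let $\bm U_h^I\in\mathbb V_h^{I,k}$ and $\bm U_h^J\in\mathbb V_h^{J,k}$, with $\overline{\bm U}_{ij}^I\in\mathcal G$ and $\overline{\bm U}_{i+\frac12,j+\frac12}^J\in\mathcal G$ for all $i,j$. Consider a feasible 2D symmetric cell average decomposition for $\mathbb P^k$ with $\lambda_1=\frac1{\Delta x}$, $\lambda_2=\frac1{\Delta y}$ and boundary weight $\bar\omega$, let $\mathcal Q_{ij}$ be the associated node sets, and suppose $$\bm U_h^I(x,y)\in\mathcal G,\qquad\bm U_h^J(x,y)\in\mathcal G\qquad\forall(x,y)\in\mathcal Q_{ij},\ \forall i,j.$$ Then, under the CFL condition $$0<\Delta t\left(\frac1{\Delta x}+\frac1{\Delta y}\right)\le\frac{\theta\bar\omega}2,\qquad\theta=\frac{\Delta t}{\tau_{\max}}\in(0,1],$$ the updated cell averages $$\overline{\bm U}_{ij}^{I,\mathcal H,\Delta t}:=\overline{\bm U}_{ij}^I+\Delta t\,\mathcal H_{ij}^I(\bm U_h^I,\bm U_h^J),\qquad\overline{\bm U}_{i+\frac12,j+\frac12}^{J,\mathcal H,\Delta t}:=\overline{\bm U}_{i+\frac12,j+\frac12}^J+\Delta t\,\mathcal H_{i+\frac12,j+\frac12}^J(\bm U_h^J,\bm U_h^I)$$ satisfy, for all $i,j$, $$\overline{\bm U}_{ij}^{I,\mathcal H,\Delta t}\cdot\bm n_1>0,\qquad\overline{\bm U}_{i+\frac12,j+\frac12}^{J,\mathcal H,\Delta t}\cdot\bm n_1>0,$$ $$\overline{\bm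 U}_{ij}^{I,\mathcal H,\Delta t}\cdot\bm n^*+p_m^*>-\Delta t\,(\bm v^*\cdot\bm B^* )\,\big(\mathrm{div}_{ij}\bm B_h^J\big),$$ $$\overline{\bm U}_{i+\frac12,j+\frac12}^{J,\mathcal H,\Delta t}\cdot\bm n^*+p_m^*>-\Delta t\,(\bm v^*\cdot\bm B^* )\,\big(\mathrm{div}_{i+\frac12,j+\frac12}\bm B_h^I\big)$$ for any $\bm v^*\in\mathbb R^3$ with $|\bm v^*|<1$ and any $\bm B^*\in\mathbb R^3$. Furthermore, these estimates imply $\overline{\bm U}_{ij}^{I,\mathcal H,\Delta t}\in\mathcal G$ and $\overline{\bm U}_{i+\frac12,j+\frac12}^{J,\mathcal H,\Delta t}\in\mathcal G$ if $\bm U_h^J$ and $\bm U_h^I$ satisfy the discrete divergence-free condition $$\mathrm{div}_{ij}\bm B_h^J=0,\qquad\mathrm{div}_{i+\frac12,j+\frac12}\bm B_h^I=0.$$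
   Context: **RMHD.** States are $\bm U=(D,\bm m,\bm B,E)^\top\in\mathbb R^8$ with $\bm m=(m_1,m_2,m_3)$, $\bm B=(B_1,B_2,B_3)$. They are related to primitive variables $(\rho,\bm v,\bm B,p)$, $\bm v=(v_1,v_2,v_3)$, by $D=\rho W$, $m_i=\rho hW^2v_i+|\bm B|^2v_i-(\bm v\cdot\bm B)B_i$, $E=\rho hW^2-p_{tot}+|\bm B|^2$, where $W=(1-|\bm v|^2)^{-1/2}$, $p_{tot}=p+p_m$, $p_m=\frac12\big((1-|\bm v|^2)|\bm B|^2+(\bm v\cdot\bm B)^2\big)$ (speed of light $=1$). The specific enthalpy $h=h(p,\rho)=1+e(p,\rho)+p/\rho$ is a given differentiable equation of state with $h(p,\rho)\ge\sqrt{1+p^2/\rho^2}+p/\rho$ and $h\big(\frac1\rho-\frac{\partial h}{\partial p}\big)<\frac{\partial h}{\partial\rho}<0$. Fluxes: $\bm F_i(\bm U)=\big(Dv_i,\ v_i\bm m-B_i(W^{-2}\bm B+(\bm v\cdot\bm B)\bm v)+p_{tot}\bm e_i,\ v_i\bm B-B_i\bm v,\ m_i\big)^\top$, with $\bm e_i$ the $i$th row of the $3\times3$ identity. The admissible set is $\mathcal G=\{\bm U: D>0,\ p(\bm U)>0,\ |\bm v(\bm U)|<1\}$, where $p(\bm U),\bm v(\bm U)$ are the primitive quantities determined implicitly by $\bm U$; i.e. $\mathcal G$ consists of the $\bm U$ arising from primitive variables with $\rho>0$, $p>0$, $|\bm v|<1$ (these are then unique). $\mathcal G$ is convex. **Auxiliary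 vectors.** $\bm n_1=(1,0,0,0,0,0,0,0)^\top$; for $|\bm v^*|<1$ and $\bm B^*\in\mathbb R^3$, $\bm n^*=\big(-\sqrt{1-|\bm v^*|^2},\ -\bm v^*,\ -(1-|\bm v^*|^2)\bm B^*-(\bm v^*\cdot\bm B^* )\bm v^*,\ 1\big)^\top\in\mathbb R^8$ and $p_m^*=\frac12\big((1-|\bm v^*|^2)|\bm B^*|^2+(\bm v^*\cdot\bm B^* )^2\big)$. **Overlapping meshes.** Primal cells $I_{ij}=(x_{i-\frac12},x_{i+\frac12})\times(y_{j-\frac12},y_{j+\frac12})$, uniform with sizes $\Delta x,\Delta y$ and centers $(x_i,y_j)$; dual cells $J_{i+\frac12,j+\frac12}=(x_i,x_{i+1})\times(y_j,y_{j+1})$. Boundary issues are disregarded (all referenced cells exist). $x_{i\pm\frac14}=x_i\pm\frac14\Delta x$, $y_{j\pm\frac14}=y_j\pm\frac14\Delta y$ (likewise with half-integer base indices). $Q=k+1$; $\{x_{i\pm\frac14}^\mu\}_{\mu=1}^Q$ and $\{y_{j\pm\frac14}^\mu\}_{\mu=1}^Q$ are the $Q$-point Gauss nodes in $[x_{i\pm\frac14}-\frac{\Delta x}4,x_{i\pm\frac14}+\frac{\Delta x}4]$ and $[y_{j\pm\frac14}-\frac{\Delta y}4,y_{j\pm\frac14}+\frac{\Delta y}4]$, with weights $\omega_\mu$, $\sum_\mu\omega_\mu=1$. **Spaces.** $\mathbb V_h^{I,k}$ (resp. $\mathbb V_h^{J,k}$) is the set of $\mathbb R^8$-valued functions whose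 components restricted to each $I_{ij}$ (resp. $J_{i+\frac12,j+\frac12}$) are polynomials of total degree $\le k$ and whose 5th and 6th components $(B_1,B_2)$ satisfy $\partial_xB_1+\partial_yB_2=0$ inside each cell. $B_{\ell,h}^I,B_{\ell,h}^J$ denote the $B_\ell$ components of $\bm U_h^I,\bm U_h^J$. Cell averages: $\overline{\bm U}_{ij}^\bullet=\frac1{\Delta x\Delta y}\int_{I_{ij}}\bm U_h^\bullet$, $\overline{\bm U}_{i+\frac12,j+\frac12}^\bullet=\frac1{\Delta x\Delta y}\int_{J_{i+\frac12,j+\frac12}}\bm U_h^\bullet$, $\bullet\in\{I,J\}$. **Cell average decomposition (CAD).** A feasible 2D symmetric CAD on $\Omega=[-1,1]^2$ for $\mathbb P^k$, with parameters $\lambda_1,\lambda_2\ge0$, $\lambda=\lambda_1+\lambda_2>0$, is an identity valid for all polynomials $f$ of total degree $\le k$: $$\frac14\int_\Omega f=\bar\omega\sum_{\mu=1}^Q\omega_\mu\Big(\tfrac{\lambda_1}{\lambda}\big(f(-1,y^\mu)+f(1,y^\mu)\big)+\tfrac{\lambda_2}{\lambda}\big(f(x^\mu,-1)+f(x^\mu,1)\big)\Big)+\sum_{s=1}^S\tilde\omega_sf(\tilde x^s,\tilde y^s),$$ with $\bar\omega>0$, $\tilde\omega_s\ge0$, $2\bar\omega+\sum_s\tilde\omega_s=1$, $\{x^\mu\},\{y^\mu\}$ the $Q$-point Gauss nodes in $[-1,1]$, and $(\tilde x^s,\tilde y^s)\in\Omega$. The node set is $\mathcal Q_{ij}=\bigcup_{m=\pm1}\bigcup_{\sigma=\pm1}\mathcal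 Q_{i+\frac m4,j+\frac\sigma4}$ with $$\mathcal Q_{i+\frac m4,j+\frac\sigma4}=\{(x_{i+\frac m4}\pm\tfrac{\Delta x}4,y_{j+\frac\sigma4}^\mu)\}_{\mu}\cup\{(x_{i+\frac m4}^\mu,y_{j+\frac\sigma4}\pm\tfrac{\Delta y}4)\}_\mu\cup\{(x_{i+\frac m4}+\tfrac14\tilde x^s\Delta x,\ y_{j+\frac\sigma4}+\tfrac14\tilde y^s\Delta y)\}_{s}.$$ Point values of $\bm U_h^I,\bm U_h^J$ at nodes of $\mathcal Q_{i+\frac m4,j+\frac\sigma4}$ are the limits from inside the quarter cell $[x_{i+\frac m4}-\frac{\Delta x}4,x_{i+\frac m4}+\frac{\Delta x}4]\times[y_{j+\frac\sigma4}-\frac{\Delta y}4,y_{j+\frac\sigma4}+\frac{\Delta y}4]$, on which both are polynomial. **Cell-average operators without source terms**, with parameter $\tau_{\max}>0$ (sums over $m=\pm1$, $\mu=1,\dots,Q$): $$\mathcal H_{ij}^I(\bm U_h^I,\bm U_h^J)=\frac{\overline{\bm U}_{ij}^J-\overline{\bm U}_{ij}^I}{\tau_{\max}}-\frac1{\Delta x}\sum_{m,\mu}\frac{\omega_\mu}2\Big(\bm F_1(\bm U_h^J(x_{i+\frac12},y_{j+\frac m4}^\mu))-\bm F_1(\bm U_h^J(x_{i-\frac12},y_{j+\frac m4}^\mu))\Big)-\frac1{\Delta y}\sum_{m,\mu}\frac{\omega_\mu}2\Big(\bm F_2(\bm U_h^J(x_{i+\frac m4}^\mu,y_{j+\frac12}))-\bm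 F_2(\bm U_h^J(x_{i+\frac m4}^\mu,y_{j-\frac12}))\Big),$$ and $\mathcal H_{i+\frac12,j+\frac12}^J(\bm U_h^J,\bm U_h^I)$ is the same formula with the roles of $I$ and $J$ exchanged and all indices $i,j$ shifted by $\frac12$. **Discrete divergence.** $$\mathrm{div}_{ij}\bm B_h^J=\sum_{m,\mu}\frac{\omega_\mu}2\left(\frac{B_{1,h}^J(x_{i+\frac12},y_{j+\frac m4}^\mu)-B_{1,h}^J(x_{i-\frac12},y_{j+\frac m4}^\mu)}{\Delta x}+\frac{B_{2,h}^J(x_{i+\frac m4}^\mu,y_{j+\frac12})-B_{2,h}^J(x_{i+\frac m4}^\mu,y_{j-\frac12})}{\Delta y}\right),$$ $$\mathrm{div}_{i+\frac12,j+\frac12}\bm B_h^I=\sum_{m,\mu}\frac{\omega_\mu}2\left(\frac{B_{1,h}^I(x_{i+1},y_{j+\frac12+\frac m4}^\mu)-B_{1,h}^I(x_{i},y_{j+\frac12+\frac m4}^\mu)}{\Delta x}+\frac{B_{2,h}^I(x_{i+\frac12+\frac m4}^\mu,y_{j+1})-B_{2,h}^I(x_{i+\frac12+\frac m4}^\mu,y_{j})}{\Delta y}\right).$$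
   Formalization: The final claim (membership in G) additionally assumes that e(p,ρ) tends to 0 as p tends to 0+ for every ρ>0; without it the claim fails, e.g. for e=(1+p)/ρ. The estimates do not need this. *)

theory Defs
  imports "HOL-Analysis.Analysis"
begin

section \<open>Relativistic magnetohydrodynamics\<close>

text \<open>A state \<open>U = (D, m, B, E)\<close> in \<open>\<real>\<^sup>8 = \<real> \<times> \<real>\<^sup>3 \<times> \<real>\<^sup>3 \<times> \<real>\<close>. The Euclidean structure on this
  product is the one of \<open>\<real>\<^sup>8\<close>, so \<open>\<bullet>\<close> is the usual scalar product and the eight components
  are the scalar products with the elements of \<open>Basis\<close>.\<close>

type_synonym state = "real \<times> (real^3) \<times> (real^3) \<times> real"

definition magnetic :: "state \<Rightarrow> real^3" where
  "magnetic U = fst (snd (snd U))"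

text \<open>The equation of state is given through the specific internal energy \<open>e p \<rho>\<close>.\<close>

definition enthalpy :: "(real \<Rightarrow> real \<Rightarrow> real) \<Rightarrow> real \<Rightarrow> real \<Rightarrow> real" where
  "enthalpy e p \<rho> = 1 + e p \<rho> + p / \<rho>"

definition equation_of_state :: "(real \<Rightarrow> real \<Rightarrow> real) \<Rightarrow> bool" where
  "equation_of_state e \<longleftrightarrow>
     (\<forall>p>0. \<forall>\<rho>>0.
        (\<lambda>(p, \<rho>). enthalpy e p \<rho>) differentiable at (p, \<rho>) \<and>
        enthalpy e p \<rho> \<ge> sqrt (1 + p\<^sup>2 / \<rho>\<^sup>2) + p / \<rho> \<and>
        enthalpy e p \<rho> * (1 / \<rho> - deriv (\<lambda>q. enthalpy e q \<rho>) p) < deriv (\<lambda>r. enthalpy e p r) \<rho> \<and>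
        deriv (\<lambda>r. enthalpy e p r) \<rho> < 0)"

text \<open>These conditions do not force \<open>e p \<rho> \<longlongrightarrow> 0\<close> as \<open>p \<longlongrightarrow> 0\<close>: they hold for \<open>e p \<rho> = (1 + p) / \<rho>\<close>,
  for which the scheme can leave the admissible set. Where that limit is needed, it is assumed
  separately.\<close>

definition lorentz :: "real^3 \<Rightarrow> real" where
  "lorentz v = 1 / sqrt (1 - (norm v)\<^sup>2)"

definition mag_pressure :: "real^3 \<Rightarrow> real^3 \<Rightarrow> real" where
  "mag_pressure v B = ((1 - (norm v)\<^sup>2) * (norm B)\<^sup>2 + (v \<bullet> B)\<^sup>2) / 2"

definition conserved ::
  "(real \<Rightarrow> real \<Rightarrow> real) \<Rightarrow> real \<Rightarrow> real^3 \<Rightarrow> real^3 \<Rightarrow> real \<Rightarrow> state" where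
  "conserved e \<rho> v B p =
     (let W = lorentz v; h = enthalpy e p \<rho>; ptot = p + mag_pressure v B in
       (\<rho> * W,
        (\<rho> * h * W\<^sup>2) *\<^sub>R v + (norm B)\<^sup>2 *\<^sub>R v - (v \<bullet> B) *\<^sub>R B,
        B,
        \<rho> * h * W\<^sup>2 - ptot + (norm B)\<^sup>2))"

definition admissible :: "(real \<Rightarrow> real \<Rightarrow> real) \<Rightarrow> state set" where
  "admissible e = {conserved e \<rho> v B p | \<rho> v B p. \<rho> > 0 \<and> p > 0 \<and> norm v < 1}"

text \<open>Recovery of the primitive variables \<open>(\<rho>, v, B, p)\<close> of an admissible state. They are unique,
  so it is immaterial which solution \<open>SOME\<close> picks; on non-admissible states the value is
  unspecified.\<close>

definition primitive :: "(real \<Rightarrow> real \<Rightarrow> real) \<Rightarrow> state \<Rightarrow> real \<times> (real^3) \<times> (real^3) \<times> real" where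
  "primitive e U = (SOME (\<rho>, v, B, p). \<rho> > 0 \<and> p > 0 \<and> norm v < 1 \<and> U = conserved e \<rho> v B p)"

definition flux :: "(real \<Rightarrow> real \<Rightarrow> real) \<Rightarrow> 3 \<Rightarrow> state \<Rightarrow> state" where
  "flux e i U =
     (case U of (D, m, _, _) \<Rightarrow> case primitive e U of (\<rho>, v, B, p) \<Rightarrow>
       (let W = lorentz v; ptot = p + mag_pressure v B in
         (D * v $ i,
          (v $ i) *\<^sub>R m - (B $ i) *\<^sub>R ((1 / W\<^sup>2) *\<^sub>R B + (v \<bullet> B) *\<^sub>R v) + ptot *\<^sub>R axis i 1,
          (v $ i) *\<^sub>R B - (B $ i) *\<^sub>R v,
          m $ i)))"

definition n_one :: state where
  "n_one = (1, 0, 0, 0)"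

definition n_star :: "real^3 \<Rightarrow> real^3 \<Rightarrow> state" where
  "n_star v B =
     (- sqrt (1 - (norm v)\<^sup>2), - v, - ((1 - (norm v)\<^sup>2) *\<^sub>R B) - (v \<bullet> B) *\<^sub>R v, 1)"

section \<open>Overlapping meshes\<close>

record mesh =
  xorig :: real
  yorig :: real
  dx :: real
  dy :: real

text \<open>The grid point \<open>x\<^sub>a = x\<^sub>0 + a \<Delta>x\<close> is defined for every real index \<open>a\<close>, so that integer,
  half-integer and quarter-integer indices are covered uniformly. With integers \<open>i\<close>, \<open>j\<close>, the cell
  with index \<open>(i, j)\<close> is the primal cell and the one with index \<open>(i + 1/2, j + 1/2)\<close> is the
  dual cell.\<close>

definition xpt :: "mesh \<Rightarrow> real \<Rightarrow> real" where
  "xpt M a = xorig M + a * dx M"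

definition ypt :: "mesh \<Rightarrow> real \<Rightarrow> real" where
  "ypt M b = yorig M + b * dy M"

definition cell :: "mesh \<Rightarrow> real \<Rightarrow> real \<Rightarrow> (real \<times> real) set" where
  "cell M a b = {xpt M (a - 1/2) <..< xpt M (a + 1/2)} \<times> {ypt M (b - 1/2) <..< ypt M (b + 1/2)}"

definition primal_cells :: "mesh \<Rightarrow> (real \<times> real) set set" where
  "primal_cells M = {cell M (of_int i) (of_int j) | i j. True}"

definition dual_cells :: "mesh \<Rightarrow> (real \<times> real) set set" where
  "dual_cells M = {cell M (of_int i + 1/2) (of_int j + 1/2) | i j. True}"

definition quarter_cell :: "mesh \<Rightarrow> real \<Rightarrow> real \<Rightarrow> (real \<times> real) set" where
  "quarter_cell M a b =
     {xpt M a - dx M / 4 <..< xpt M a + dx M / 4} \<times> {ypt M b - dy M / 4 <..< ypt M b + dy M / 4}"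

definition quarter_trace ::
  "mesh \<Rightarrow> real \<Rightarrow> real \<Rightarrow> (real \<times> real \<Rightarrow> state) \<Rightarrow> real \<times> real \<Rightarrow> state" where
  "quarter_trace M a b U z = Lim (at z within quarter_cell M a b) U"

section \<open>Quadrature and cell average decomposition\<close>

definition poly2_on :: "nat \<Rightarrow> (real \<times> real) set \<Rightarrow> (real \<times> real \<Rightarrow> real) \<Rightarrow> bool" where
  "poly2_on k C f \<longleftrightarrow>
     (\<exists>c :: nat \<Rightarrow> nat \<Rightarrow> real. \<forall>(x, y)\<in>C. f (x, y) = (\<Sum>a\<le>k. \<Sum>b\<le>k - a. c a b * x ^ a * y ^ b))"

text \<open>The \<open>Q\<close>-point Gauss rule on \<open>[-1, 1]\<close>, with weights normalised to sum up to 1: the rule with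
  \<open>Q\<close> distinct nodes which is exact for polynomials of degree at most \<open>2 Q - 1\<close>.\<close>

definition gauss_rule :: "nat \<Rightarrow> (nat \<Rightarrow> real) \<Rightarrow> (nat \<Rightarrow> real) \<Rightarrow> bool" where
  "gauss_rule Q gx gw \<longleftrightarrow>
     inj_on gx {1..Q} \<and> gx ` {1..Q} \<subseteq> {-1..1} \<and> (\<Sum>\<mu>=1..Q. gw \<mu>) = 1 \<and>
     (\<forall>f :: real poly. degree f < 2 * Q \<longrightarrow>
        integral {-1..1} (poly f) / 2 = (\<Sum>\<mu>=1..Q. gw \<mu> * poly f (gx \<mu>)))"

definition cad ::
  "nat \<Rightarrow> (nat \<Rightarrow> real) \<Rightarrow> (nat \<Rightarrow> real) \<Rightarrow> real \<Rightarrow> real \<Rightarrow> real \<Rightarrow>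
   nat \<Rightarrow> (nat \<Rightarrow> real) \<Rightarrow> (nat \<Rightarrow> real) \<Rightarrow> (nat \<Rightarrow> real) \<Rightarrow> bool" where
  "cad k gx gw l1 l2 wbar S wt xt yt \<longleftrightarrow>
     l1 \<ge> 0 \<and> l2 \<ge> 0 \<and> l1 + l2 > 0 \<and> wbar > 0 \<and>
     (\<forall>s\<in>{1..S}. wt s \<ge> 0 \<and> (xt s, yt s) \<in> {-1..1} \<times> {-1..1}) \<and>
     2 * wbar + (\<Sum>s=1..S. wt s) = 1 \<and>
     (\<forall>f. poly2_on k UNIV f \<longrightarrow>
        integral ({-1..1} \<times> {-1..1}) f / 4 =
          wbar * (\<Sum>\<mu>=1..k+1. gw \<mu> *
              (l1 / (l1 + l2) * (f (-1, gx \<mu>) + f (1, gx \<mu>)) +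
               l2 / (l1 + l2) * (f (gx \<mu>, -1) + f (gx \<mu>, 1))))
          + (\<Sum>s=1..S. wt s * f (xt s, yt s)))"

text \<open>Gauss nodes in the intervals of half-width \<open>\<Delta>x/4\<close> (resp. \<open>\<Delta>y/4\<close>) around \<open>x\<^sub>a\<close>
  (resp. \<open>y\<^sub>b\<close>).\<close>

definition xgauss :: "mesh \<Rightarrow> (nat \<Rightarrow> real) \<Rightarrow> real \<Rightarrow> nat \<Rightarrow> real" where
  "xgauss M gx a \<mu> = xpt M a + gx \<mu> * dx M / 4"

definition ygauss :: "mesh \<Rightarrow> (nat \<Rightarrow> real) \<Rightarrow> real \<Rightarrow> nat \<Rightarrow> real" where
  "ygauss M gx b \<mu> = ypt M b + gx \<mu> * dy M / 4"

definition quarter_nodes ::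
  "mesh \<Rightarrow> nat \<Rightarrow> (nat \<Rightarrow> real) \<Rightarrow> nat \<Rightarrow> (nat \<Rightarrow> real) \<Rightarrow> (nat \<Rightarrow> real) \<Rightarrow>
   real \<Rightarrow> real \<Rightarrow> (real \<times> real) set" where
  "quarter_nodes M Q gx S xt yt a b =
     {(xpt M a + r * dx M / 4, ygauss M gx b \<mu>) | r \<mu>. r \<in> {-1, 1} \<and> \<mu> \<in> {1..Q}} \<union>
     {(xgauss M gx a \<mu>, ypt M b + r * dy M / 4) | r \<mu>. r \<in> {-1, 1} \<and> \<mu> \<in> {1..Q}} \<union>
     {(xpt M a + xt s * dx M / 4, ypt M b + yt s * dy M / 4) | s. s \<in> {1..S}}"

section \<open>The scheme\<close>

text \<open>Locally divergence-free piecewise polynomials on a family of (open, disjoint) cells. Nothing is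
  required of the values on the cell edges.\<close>

definition dg_space :: "nat \<Rightarrow> (real \<times> real) set set \<Rightarrow> (real \<times> real \<Rightarrow> state) set" where
  "dg_space k \<C> =
     {U. \<forall>C\<in>\<C>.
          (\<forall>b\<in>Basis. poly2_on k C (\<lambda>z. U z \<bullet> b)) \<and>
          (\<forall>(x, y)\<in>C. deriv (\<lambda>s. magnetic (U (s, y)) $ 1) x + deriv (\<lambda>t. magnetic (U (x, t)) $ 2) y = 0)}"

definition cell_avg :: "mesh \<Rightarrow> (real \<times> real \<Rightarrow> state) \<Rightarrow> real \<Rightarrow> real \<Rightarrow> state" where
  "cell_avg M U a b = (1 / (dx M * dy M)) *\<^sub>R integral (cell M a b) U"

text \<open>The cell-average operator on the cell with index \<open>(a, b)\<close>: \<open>U\<close> is the numerical solution on the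
  mesh containing this cell and \<open>V\<close> the one on the other mesh. The points at which \<open>V\<close> is
  evaluated lie in the interior of cells of that other mesh.\<close>

definition cell_op ::
  "(real \<Rightarrow> real \<Rightarrow> real) \<Rightarrow> mesh \<Rightarrow> nat \<Rightarrow> (nat \<Rightarrow> real) \<Rightarrow> (nat \<Rightarrow> real) \<Rightarrow> real \<Rightarrow>
   (real \<times> real \<Rightarrow> state) \<Rightarrow> (real \<times> real \<Rightarrow> state) \<Rightarrow> real \<Rightarrow> real \<Rightarrow> state" where
  "cell_op e M Q gx gw \<tau> U V a b =
     (1 / \<tau>) *\<^sub>R (cell_avg M V a b - cell_avg M U a b)
     - (1 / dx M) *\<^sub>R (\<Sum>m\<in>{-1, 1}. \<Sum>\<mu>=1..Q. (gw \<mu> / 2) *\<^sub>R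
         (flux e 1 (V (xpt M (a + 1/2), ygauss M gx (b + m/4) \<mu>))
          - flux e 1 (V (xpt M (a - 1/2), ygauss M gx (b + m/4) \<mu>))))
     - (1 / dy M) *\<^sub>R (\<Sum>m\<in>{-1, 1}. \<Sum>\<mu>=1..Q. (gw \<mu> / 2) *\<^sub>R
         (flux e 2 (V (xgauss M gx (a + m/4) \<mu>, ypt M (b + 1/2)))
          - flux e 2 (V (xgauss M gx (a + m/4) \<mu>, ypt M (b - 1/2)))))"

definition updated_avg ::
  "(real \<Rightarrow> real \<Rightarrow> real) \<Rightarrow> mesh \<Rightarrow> nat \<Rightarrow> (nat \<Rightarrow> real) \<Rightarrow> (nat \<Rightarrow> real) \<Rightarrow> real \<Rightarrow> real \<Rightarrow>
   (real \<times> real \<Rightarrow> state) \<Rightarrow> (real \<times> real \<Rightarrow> state) \<Rightarrow> real \<Rightarrow> real \<Rightarrow> state" where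
  "updated_avg e M Q gx gw \<tau> dt U V a b =
     cell_avg M U a b + dt *\<^sub>R cell_op e M Q gx gw \<tau> U V a b"

definition discrete_div ::
  "mesh \<Rightarrow> nat \<Rightarrow> (nat \<Rightarrow> real) \<Rightarrow> (nat \<Rightarrow> real) \<Rightarrow> (real \<times> real \<Rightarrow> state) \<Rightarrow> real \<Rightarrow> real \<Rightarrow> real" where
  "discrete_div M Q gx gw V a b =
     (\<Sum>m\<in>{-1, 1}. \<Sum>\<mu>=1..Q. gw \<mu> / 2 *
        ((magnetic (V (xpt M (a + 1/2), ygauss M gx (b + m/4) \<mu>)) $ 1
          - magnetic (V (xpt M (a - 1/2), ygauss M gx (b + m/4) \<mu>)) $ 1) / dx M
       + (magnetic (V (xgauss M gx (a + m/4) \<mu>, ypt M (b + 1/2))) $ 2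
          - magnetic (V (xgauss M gx (a + m/4) \<mu>, ypt M (b - 1/2))) $ 2) / dy M))"

end

theory Submission
  imports Defs
begin

text \<open>For an admissible \<open>U\<close> and \<open>s = \<plusminus>1\<close> the expression
  \<open>(U - s F\<^sub>i) \<bullet> n\<^sup>* + p\<^sub>m\<^sup>* - s (v\<^sub>i\<^sup>* p\<^sub>m\<^sup>* - B\<^sub>i (v\<^sup>* \<bullet> B\<^sup>*))\<close> is nonnegative: covariantly it
  contracts the stress-energy tensor and the field with the null vector \<open>(1, -s e\<^sub>i)\<close>, and
  its fluid part is nonnegative by the equation of state, its magnetic part by being a sum of
  squares. The cell average decomposition on the four quarter cells writes the average over
  the cell as a convex combination of admissible point values; under the CFL condition those on the
  cell boundary carry enough weight to absorb the fluxes. The terms \<open>v\<^sub>i\<^sup>* p\<^sub>m\<^sup>*\<close>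
  cancel between opposite edges and the terms \<open>B\<^sub>i (v\<^sup>* \<bullet> B\<^sup>*)\<close> add up to the discrete
  divergence. Conversely, a state with \<open>D > 0\<close> that satisfies all the linear inequalities is
  admissible: \<open>\<rho> h W\<^sup>2\<close> is found with the intermediate value theorem, the inequality
  with \<open>v\<^sup>*\<close>, \<open>B\<^sup>*\<close> equal to the velocity and the field of the candidate giving the sign at
  the end where the pressure vanishes.\<close>

section \<open>Flux estimates for admissible states\<close>

text \<open>This is the magnetic half of the flux estimate in coordinates, for \<open>s = 1\<close>
  and flux direction 1; \<open>N1\<close>, \<open>N2\<close>, \<open>N3\<close> form minus the
  magnetic block of \<open>n_star\<close>. Over scalars the claim comes down to one polynomial
  identity that exhibits a sum of squares.\<close>

lemma magnetic_scalar_bound: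
  fixes v1 v2 v3 w1 w2 w3 B1 B2 B3 C1 C2 C3 :: real
  assumes "g' \<ge> 0" "w1 < 1"
    and pm: "pm = (g * b + vB\<^sup>2) / 2" "qm = (g' * c + wC\<^sup>2) / 2"
    and scalars: "vB = v1 * B1 + v2 * B2 + v3 * B3" "wC = w1 * C1 + w2 * C2 + w3 * C3"
    "g = 1 - (v1\<^sup>2 + v2\<^sup>2 + v3\<^sup>2)" "g' = 1 - (w1\<^sup>2 + w2\<^sup>2 + w3\<^sup>2)"
    "b = B1\<^sup>2 + B2\<^sup>2 + B3\<^sup>2" "c = C1\<^sup>2 + C2\<^sup>2 + C3\<^sup>2"
    and vectors: "m1 = b * v1 - vB * B1" "m2 = b * v2 - vB * B2" "m3 = b * v3 - vB * B3"
    "N1 = g' * C1 + wC * w1" "N2 = g' * C2 + wC * w2" "N3 = g' * C3 + wC * w3"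
  shows "0 \<le> b - pm - (m1 * w1 + m2 * w2 + m3 * w3) - (B1 * N1 + B2 * N2 + B3 * N3) + qm
      - (m1 - ((v1 * m1 - B1 * (g * B1 + vB * v1) + pm) * w1 + (v1 * m2 - B1 * (g * B2 + vB * v2)) * w2
             + (v1 * m3 - B1 * (g * B3 + vB * v3)) * w3)
         - ((v1 * B2 - B1 * v2) * N2 + (v1 * B3 - B1 * v3) * N3)) - w1 * qm + B1 * wC"
    (is "0 \<le> ?M")
proof -
  txt \<open>Up to factors and modulo the null vector \<open>\<xi> = (1, -1, 0, 0)\<close>, \<open>p\<close> and \<open>r\<close> are the projections of the covariant
    fields to the orthogonal complement of \<open>\<xi>\<close>, which is a Euclidean plane.\<close>
  define x y where xy: "x = 1 - v1" "y = 1 - w1"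
  define p2 p3 r2 r3 where pr: "p2 = y * C2 + C1 * w2" "p3 = y * C3 + C1 * w3"
    "r2 = x * B2 + B1 * v2" "r3 = x * B3 + B1 * v3"
  \<comment> \<open>\<open>?P\<close> is twice the claim with the halves in \<open>pm\<close> and
    \<open>qm\<close> cleared, so that the identity to be checked is polynomial.\<close>
  let ?P = "2 * (b - (m1 * w1 + m2 * w2 + m3 * w3) - (B1 * N1 + B2 * N2 + B3 * N3)
      - (m1 - ((v1 * m1 - B1 * (g * B1 + vB * v1)) * w1 + (v1 * m2 - B1 * (g * B2 + vB * v2)) * w2
             + (v1 * m3 - B1 * (g * B3 + vB * v3)) * w3)
         - ((v1 * B2 - B1 * v2) * N2 + (v1 * B3 - B1 * v3) * N3)) + B1 * wC)
      - (1 - w1) * (g * b + vB\<^sup>2) + (1 - w1) * (g' * c + wC\<^sup>2)"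
  have vw: "v1 = 1 - x" "w1 = 1 - y" using xy by simp_all
  have "g * b + vB\<^sup>2 = 2 * pm" "g' * c + wC\<^sup>2 = 2 * qm" using pm by simp_all
  then have "2 * ?M = ?P" by (simp only:) (simp add: algebra_simps)
  \<comment> \<open>The factor \<open>y\<close>, which is positive, turns \<open>?P\<close> into
    squares with the nonnegative weights \<open>g'\<close> and 1; it is cancelled at the
    end.\<close>
  moreover have "y * ?P = g' * ((p2 - r2)\<^sup>2 + (p3 - r3)\<^sup>2)
      + (w2 * (p2 - r2) + w3 * (p3 - r3) - y * (C1 - B1))\<^sup>2
      + (w2 * r3 - w3 * r2 - y * (v2 * B3 - v3 * B2))\<^sup>2"
    unfolding vectors scalars pr vw by algebra
  moreover have "\<dots> \<ge> 0" using assms by simp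
  ultimately have "0 \<le> y * (2 * ?M)" by presburger
  then show ?thesis using assms(2) xy by (simp add: zero_le_mult_iff)
qed

text \<open>Squaring the enthalpy bound gives \<open>1 \<le> h * (h - 2 * (p / \<rho>))\<close>, so
  the quadratic form \<open>h * X\<^sup>2 - 2 * X * y + (h - 2 * (p / \<rho>)) * y\<^sup>2\<close>
  has nonnegative determinant. In the flux estimate \<open>g\<close>, \<open>g'\<close> are inverse
  squared Lorentz factors, \<open>x\<close>, \<open>y\<close> are \<open>1 - s * v $ i\<close>,
  \<open>1 - s * w $ i\<close>, and \<open>G\<close> is \<open>1 - v \<bullet> w\<close>.\<close>

lemma hydro_scalar_bound:
  fixes g g' x y G :: real
  assumes "\<rho> > 0" "p > 0" "h \<ge> sqrt (1 + p\<^sup>2 / \<rho>\<^sup>2) + p / \<rho>" "g > 0" "g' > 0" "y > 0"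
    and G: "2 * G * x * y \<ge> g' * x\<^sup>2 + g * y\<^sup>2"
  shows "x * (\<rho> * h / g * G - \<rho> / sqrt g * sqrt g') - p * y \<ge> 0"
proof -
  \<comment> \<open>This scaling turns the hypothesis on \<open>G\<close> into
    \<open>X\<^sup>2 + y\<^sup>2 \<le> 2 * G * x * y / g\<close>, and \<open>X\<close> is the factor
    of \<open>\<rho>\<close> in the subtracted density term.\<close>
  define X where "X = x / sqrt g * sqrt g'"
  have X2: "X\<^sup>2 = g' * x\<^sup>2 / g" using assms by (simp add: X_def power_mult_distrib power_divide)
  have "(1 + p\<^sup>2 / \<rho>\<^sup>2) \<le> (h - p / \<rho>)\<^sup>2"
    using assms(3) by (intro sqrt_le_D) simp
  then have "1 \<le> h * (h - 2 * (p / \<rho>))" by (simp add: power2_eq_square algebra_simps)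
  have "h > 0"
    using assms(1-3) by (smt (verit) divide_pos_pos real_sqrt_ge_zero zero_le_power2 divide_nonneg_nonneg)
  have "0 \<le> (h * X - y)\<^sup>2 + (h * (h - 2 * (p / \<rho>)) - 1) * y\<^sup>2"
    using \<open>1 \<le> h * (h - 2 * (p / \<rho>))\<close> by (intro add_nonneg_nonneg mult_nonneg_nonneg) auto
  also have "\<dots> = h * (h * (X\<^sup>2 + y\<^sup>2) - 2 * (p / \<rho>) * y\<^sup>2 - 2 * X * y)"
    by (simp add: power2_eq_square algebra_simps)
  finally have "0 \<le> h * (X\<^sup>2 + y\<^sup>2) - 2 * (p / \<rho>) * y\<^sup>2 - 2 * X * y"
    using \<open>h > 0\<close> by (simp add: zero_le_mult_iff)
  moreover have "X\<^sup>2 + y\<^sup>2 \<le> 2 * G * x * y / g"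
    using divide_right_mono[OF G, of g] assms by (simp add: X2 add_divide_distrib)
  then have "h * (X\<^sup>2 + y\<^sup>2) \<le> h * (2 * G * x * y / g)"
    using \<open>h > 0\<close> by (intro mult_left_mono) auto
  ultimately have "0 \<le> h * (2 * G * x * y / g) - 2 * (p / \<rho>) * y\<^sup>2 - 2 * X * y" by linarith
  then have "0 \<le> \<rho> * (h * (2 * G * x * y / g) - 2 * (p / \<rho>) * y\<^sup>2 - 2 * X * y)"
    using assms by simp
  also have "\<dots> = 2 * y * (x * (\<rho> * h / g * G - \<rho> / sqrt g * sqrt g') - p * y)"
    using assms unfolding X_def by (simp add: field_simps power2_eq_square)
  finally show ?thesis using assms by (simp add: zero_le_mult_iff)
qed

section \<open>Fluid and field parts of a state and of its flux\<close>

definition fluid_state :: "real \<Rightarrow> real \<Rightarrow> real^3 \<Rightarrow> real \<Rightarrow> state" where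
  "fluid_state \<rho> h v p =
     (\<rho> * lorentz v, (\<rho> * h * (lorentz v)\<^sup>2) *\<^sub>R v, 0, \<rho> * h * (lorentz v)\<^sup>2 - p)"

definition fluid_flux :: "real \<Rightarrow> real \<Rightarrow> real^3 \<Rightarrow> real \<Rightarrow> 3 \<Rightarrow> state" where
  "fluid_flux \<rho> h v p i =
     (\<rho> * lorentz v * v $ i, (v $ i * (\<rho> * h * (lorentz v)\<^sup>2)) *\<^sub>R v + p *\<^sub>R axis i 1, 0,
      \<rho> * h * (lorentz v)\<^sup>2 * v $ i)"

definition field_state :: "real^3 \<Rightarrow> real^3 \<Rightarrow> state" where
  "field_state v B =
     (0, (norm B)\<^sup>2 *\<^sub>R v - (v \<bullet> B) *\<^sub>R B, B, (norm B)\<^sup>2 - mag_pressure v B)"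

definition field_flux :: "real^3 \<Rightarrow> real^3 \<Rightarrow> 3 \<Rightarrow> state" where
  "field_flux v B i =
     (0, (v $ i) *\<^sub>R ((norm B)\<^sup>2 *\<^sub>R v - (v \<bullet> B) *\<^sub>R B)
         - (B $ i) *\<^sub>R ((1 - (norm v)\<^sup>2) *\<^sub>R B + (v \<bullet> B) *\<^sub>R v) + mag_pressure v B *\<^sub>R axis i 1,
      (v $ i) *\<^sub>R B - (B $ i) *\<^sub>R v, ((norm B)\<^sup>2 *\<^sub>R v - (v \<bullet> B) *\<^sub>R B) $ i)"

lemma lorentz_sq: "norm v < 1 \<Longrightarrow> (lorentz v)\<^sup>2 = 1 / (1 - (norm v)\<^sup>2)"
  by (simp add: lorentz_def power_divide abs_square_le_1)

lemma lorentz_ge_1: "norm v < 1 \<Longrightarrow> lorentz v \<ge> 1"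
  by (simp add: lorentz_def abs_square_less_1 field_simps)

lemma one_minus_norm_sq_pos: "norm v < 1 \<Longrightarrow> 1 - (norm v)\<^sup>2 > 0"
  by (simp add: abs_square_less_1)

lemma conserved_split:
  "conserved e \<rho> v B p = fluid_state \<rho> (enthalpy e p \<rho>) v p + field_state v B"
  by (simp add: conserved_def fluid_state_def field_state_def Let_def)

lemma primitive_admissible:
  assumes "U \<in> admissible e" "primitive e U = (\<rho>, v, B, p)"
  shows "\<rho> > 0" "p > 0" "norm v < 1" "U = conserved e \<rho> v B p"
proof -
  have "case primitive e U of (\<rho>, v, B, p) \<Rightarrow>
      \<rho> > 0 \<and> p > 0 \<and> norm v < 1 \<and> U = conserved e \<rho> v B p"
    unfolding primitive_def using assms(1)
    by (intro someI_ex[where P = "\<lambda>(\<rho>, v, B, p). \<rho> > 0 \<and> p > 0 \<and> norm v < 1 \<and> U = conserved e \<rho> v B p"])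
      (auto simp: admissible_def)
  then show "\<rho> > 0" "p > 0" "norm v < 1" "U = conserved e \<rho> v B p" using assms(2) by auto
qed

text \<open>The same primitive variables split \<open>U\<close> and its flux. As the estimates are
  linear in state and flux, fluid and field can be bounded separately and the results added.\<close>

lemma flux_split:
  assumes "U \<in> admissible e" "primitive e U = (\<rho>, v, B, p)"
  shows "flux e i U = fluid_flux \<rho> (enthalpy e p \<rho>) v p i + field_flux v B i"
proof -
  note P = primitive_admissible[OF assms]
  have W: "1 / (lorentz v)\<^sup>2 = 1 - (norm v)\<^sup>2" using P by (simp add: lorentz_sq)
  then show ?thesis
    unfolding flux_def assms(2) prod.case
    by (subst P(4)) (simp add: conserved_def fluid_flux_def field_flux_def Let_def, simp add: W algebra_simps)
qed

lemma component_less_1: "norm (v :: real^3) < 1 \<Longrightarrow> \<bar>s\<bar> = 1 \<Longrightarrow> s * v $ i < 1"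
  using component_le_norm_cart[of v i] by (smt (verit) mult_minus_left mult_cancel_right1)

lemma fluid_bound:
  assumes "\<rho> > 0" "p > 0" "h \<ge> sqrt (1 + p\<^sup>2 / \<rho>\<^sup>2) + p / \<rho>" "norm v < 1" "norm w < 1" "\<bar>s\<bar> = 1"
  shows "fluid_state \<rho> h v p \<bullet> n_star w C - s * (fluid_flux \<rho> h v p i \<bullet> n_star w C) \<ge> 0"
proof -
  let ?g = "1 - (norm v)\<^sup>2" and ?g' = "1 - (norm w)\<^sup>2"
  let ?x = "1 - s * v $ i" and ?y = "1 - s * w $ i" and ?G = "1 - v \<bullet> w"
  have s: "s = 1 \<or> s = -1" using assms by auto
  \<comment> \<open>As \<open>s\<^sup>2 = 1\<close>, the products cancel in the \<open>i\<close>-th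
    component of \<open>z\<close>, whose square is \<open>(?x - ?y)\<^sup>2\<close>. That it is at
    most \<open>z \<bullet> z\<close> is the hypothesis on \<open>G\<close> in
    \<open>hydro_scalar_bound\<close>, rearranged.\<close>
  define z where "z = ?x *\<^sub>R w - ?y *\<^sub>R v"
  have "z $ i = w $ i - v $ i" by (simp add: z_def algebra_simps)
  then have "(w $ i - v $ i)\<^sup>2 \<le> z \<bullet> z"
    using component_le_norm_cart[of z i]
    by (metis abs_ge_zero power2_abs power2_norm_eq_inner power_mono)
  also have "z \<bullet> z = ?x\<^sup>2 * (norm w)\<^sup>2 + ?y\<^sup>2 * (norm v)\<^sup>2 - 2 * ?x * ?y * (v \<bullet> w)"
    unfolding z_def power2_norm_eq_inner by (simp add: inner_simps inner_commute power2_eq_square algebra_simps)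
  finally have "2 * ?G * ?x * ?y \<ge> ?g' * ?x\<^sup>2 + ?g * ?y\<^sup>2"
    using s by (auto simp: power2_eq_square algebra_simps)
  then have "?x * (\<rho> * h / ?g * ?G - \<rho> / sqrt ?g * sqrt ?g') - p * ?y \<ge> 0"
    using assms component_less_1[of w s i]
    by (intro hydro_scalar_bound) (auto simp: one_minus_norm_sq_pos simp del: diff_gt_0_iff_gt)
  also have "?x * (\<rho> * h / ?g * ?G - \<rho> / sqrt ?g * sqrt ?g') - p * ?y
      = fluid_state \<rho> h v p \<bullet> n_star w C - s * (fluid_flux \<rho> h v p i \<bullet> n_star w C)"
    using assms(4)
    by (simp add: fluid_state_def fluid_flux_def n_star_def lorentz_sq inner_axis inner_axis' inner_simps)
      (simp add: lorentz_def algebra_simps add_divide_distrib diff_divide_distrib)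
  finally show ?thesis .
qed

lemma field_bound:
  assumes "norm w < 1" "\<bar>s\<bar> = 1"
  shows "field_state v B \<bullet> n_star w C + mag_pressure w C
    - s * (field_flux v B i \<bullet> n_star w C + w $ i * mag_pressure w C - B $ i * (w \<bullet> C)) \<ge> 0"
proof -
  \<comment> \<open>The axes are renamed so that direction \<open>i\<close> takes the first place,
    as in the scalar bound.\<close>
  obtain j l where sum: "\<And>f :: 3 \<Rightarrow> real. sum f UNIV = f i + f j + f l" and jl: "j \<noteq> i" "l \<noteq> i"
  proof -
    consider "i = 1" | "i = 2" | "i = 3" using exhaust_3 by blast
    then show thesis
      by cases (rule that[of 2 3] that[of 1 3] that[of 1 2]; simp add: sum_3)+
  qed
  have n2: "(norm u)\<^sup>2 = (u $ i)\<^sup>2 + (u $ j)\<^sup>2 + (u $ l)\<^sup>2" for u :: "real^3"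
    unfolding power2_norm_eq_inner inner_vec_def sum by (simp add: power2_eq_square)
  have in3: "u \<bullet> z = u $ i * z $ i + u $ j * z $ j + u $ l * z $ l" for u z :: "real^3"
    unfolding inner_vec_def sum by simp
  have s: "s = 1 \<or> s = -1" using assms by auto
  then have ss: "s * (s * a) = a" "s\<^sup>2 = 1" for a by auto
  define g g' vB wC b pm qm where abbr: "g = 1 - (norm v)\<^sup>2" "g' = 1 - (norm w)\<^sup>2"
    "vB = v \<bullet> B" "wC = w \<bullet> C" "b = (norm B)\<^sup>2" "pm = mag_pressure v B" "qm = mag_pressure w C"
  \<comment> \<open>Multiplying the \<open>i\<close>-th components of all four vectors by
    \<open>s\<close> preserves every scalar product and reduces \<open>s = -1\<close> to
    \<open>s = 1\<close>.\<close>
  note I = magnetic_scalar_bound[of g' "s * w $ i" pm g b vB qm "(norm C)\<^sup>2" wC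
      "s * v $ i" "s * B $ i" "v $ j" "B $ j" "v $ l" "B $ l"
      "s * C $ i" "w $ j" "C $ j" "w $ l" "C $ l", OF _ _ _ _ _ _ _ _ _ _ refl refl refl refl refl refl]
  show ?thesis
    unfolding field_state_def field_flux_def n_star_def abbr[symmetric]
    apply (rule order_trans[OF I])
    subgoal using assms one_minus_norm_sq_pos[of w] by (simp add: abbr)
    subgoal using assms by (simp add: component_less_1)
    subgoal by (simp add: abbr mag_pressure_def)
    subgoal by (simp add: abbr mag_pressure_def)
    subgoal using ss by (simp add: abbr in3 algebra_simps)
    subgoal using ss by (simp add: abbr in3 algebra_simps)
    subgoal using ss by (simp add: abbr n2 power_mult_distrib)
    subgoal using ss by (simp add: abbr n2 power_mult_distrib)
    subgoal using ss by (simp add: abbr n2 power_mult_distrib)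
    subgoal using ss by (simp add: n2 power_mult_distrib)
    using s jl
    apply (elim disjE; simp add: in3 axis_def)
    apply (simp_all add: algebra_simps)
    done
qed

text \<open>Strictness has two sources. For \<open>v = w\<close> the claim is
  \<open>\<rho> * h > \<rho> + p\<close>. Otherwise \<open>1 - v \<bullet> w\<close> strictly
  exceeds the mean of \<open>?g\<close> and \<open>?g'\<close>, and
  \<open>hydro_scalar_bound\<close> applies to that mean with \<open>x = y = 1\<close>.\<close>

lemma fluid_pos:
  assumes "\<rho> > 0" "p > 0" "h \<ge> sqrt (1 + p\<^sup>2 / \<rho>\<^sup>2) + p / \<rho>" "norm v < 1" "norm w < 1"
  shows "fluid_state \<rho> h v p \<bullet> n_star w C > 0"
proof -
  let ?g = "1 - (norm v)\<^sup>2" and ?g' = "1 - (norm w)\<^sup>2"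
  have g: "?g > 0" "?g' > 0" using assms one_minus_norm_sq_pos by blast+
  have "sqrt (1 + p\<^sup>2 / \<rho>\<^sup>2) > 1" using assms by simp
  then have h: "h > 1 + p / \<rho>" using assms by linarith
  then have "h > 0" using assms by (smt (verit) divide_pos_pos)
  have eq: "fluid_state \<rho> h v p \<bullet> n_star w C
      = \<rho> * h / ?g * (1 - v \<bullet> w) - \<rho> / sqrt ?g * sqrt ?g' - p"
    using assms(4) by (simp add: fluid_state_def n_star_def lorentz_sq)
      (simp add: lorentz_def algebra_simps diff_divide_distrib)
  show ?thesis
  proof (cases "v = w")
    case True
    have "\<rho> * h > \<rho> + p" using h assms by (simp add: field_simps)
    then show ?thesis unfolding eq using True g by (simp add: power2_norm_eq_inner)
  next
    case False
    have "(v - w) \<bullet> (v - w) > 0" using False by simp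
    then have "(?g + ?g') / 2 < 1 - v \<bullet> w"
      unfolding power2_norm_eq_inner by (simp add: inner_simps inner_commute)
    then have "\<rho> * h / ?g * ((?g + ?g') / 2) < \<rho> * h / ?g * (1 - v \<bullet> w)"
      using g assms \<open>h > 0\<close> by (intro mult_strict_left_mono) auto
    moreover have "1 * (\<rho> * h / ?g * ((?g + ?g') / 2) - \<rho> / sqrt ?g * sqrt ?g') - p * 1 \<ge> 0"
      using g assms(1-3) by (intro hydro_scalar_bound) auto
    moreover have "X < Y \<Longrightarrow> 1 * (X - Z) - p * 1 \<ge> 0 \<Longrightarrow> Y - Z - p > 0" for X Y Z :: real by simp
    ultimately show ?thesis unfolding eq by blast
  qed
qed

context
  fixes e U
  assumes eos: "equation_of_state e" and U: "U \<in> admissible e"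
begin

lemma n_star_flux_bound:
  assumes "norm w < 1" "\<bar>s\<bar> = 1"
  shows "U \<bullet> n_star w C + mag_pressure w C
    - s * (flux e i U \<bullet> n_star w C + w $ i * mag_pressure w C - magnetic U $ i * (w \<bullet> C)) \<ge> 0"
proof -
  obtain \<rho> v B p where P: "primitive e U = (\<rho>, v, B, p)" by (metis prod_cases4)
  note Q = primitive_admissible[OF U P]
  have "enthalpy e p \<rho> \<ge> sqrt (1 + p\<^sup>2 / \<rho>\<^sup>2) + p / \<rho>"
    using eos Q unfolding equation_of_state_def by blast
  note F = fluid_bound[OF Q(1,2) this Q(3) assms, of C i]
  have "magnetic U = B" using Q(4) by (simp add: conserved_def magnetic_def Let_def)
  then show ?thesis
    using F field_bound[OF assms, of v B C i]
    unfolding flux_split[OF U P] by (subst Q(4)) (simp add: conserved_split inner_add_left algebra_simps)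
qed

lemma n_star_pos:
  assumes "norm w < 1"
  shows "U \<bullet> n_star w C + mag_pressure w C > 0"
proof -
  obtain \<rho> v B p where P: "primitive e U = (\<rho>, v, B, p)" by (metis prod_cases4)
  note Q = primitive_admissible[OF U P]
  have "enthalpy e p \<rho> \<ge> sqrt (1 + p\<^sup>2 / \<rho>\<^sup>2) + p / \<rho>"
    using eos Q unfolding equation_of_state_def by blast
  note F = fluid_pos[OF Q(1,2) this Q(3) assms, of C]
  \<comment> \<open>Adding the bounds for the two signs cancels the flux terms.\<close>
  have "field_state v B \<bullet> n_star w C + mag_pressure w C \<ge> 0"
    using field_bound[OF assms, of 1 v B C 1] field_bound[OF assms, of "-1" v B C 1] by simp
  with F show ?thesis by (subst Q(4)) (simp add: conserved_split inner_add_left)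
qed

end

lemma
  assumes U: "U \<in> admissible e"
  shows n_one_pos: "U \<bullet> n_one > 0"
  and n_one_flux_bound: "\<bar>s\<bar> = 1 \<Longrightarrow> s * (flux e i U \<bullet> n_one) \<le> U \<bullet> n_one"
proof -
  obtain \<rho> v B p where P: "primitive e U = (\<rho>, v, B, p)" by (metis prod_cases4)
  note Q = primitive_admissible[OF U P]
  have W: "\<rho> * lorentz v > 0" using Q lorentz_ge_1[of v] by simp
  have eq: "U \<bullet> n_one = \<rho> * lorentz v"
    by (subst Q(4)) (simp add: conserved_def n_one_def Let_def)
  then show "U \<bullet> n_one > 0" using W by simp
  assume "\<bar>s\<bar> = 1"
  then have "\<rho> * lorentz v * (1 - s * v $ i) \<ge> 0"
    using W component_less_1[OF Q(3), of s i] by (intro mult_nonneg_nonneg[of "\<rho> * lorentz v"]) auto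
  then show "s * (flux e i U \<bullet> n_one) \<le> U \<bullet> n_one"
    unfolding eq flux_split[OF U P]
    by (simp add: fluid_flux_def field_flux_def n_one_def algebra_simps)
qed

section \<open>Recovery of the primitive variables\<close>

text \<open>The 1 under the root is dropped. The bound fixes the sign at the upper end of the search
  for \<open>\<rho> h W\<^sup>2\<close>.\<close>

lemma enthalpy_ge:
  assumes "equation_of_state e" "p > 0" "\<rho> > 0"
  shows "enthalpy e p \<rho> \<ge> 2 * p / \<rho>"
proof -
  have "p / \<rho> = sqrt ((p / \<rho>)\<^sup>2)" using assms by simp
  also have "\<dots> \<le> sqrt (1 + p\<^sup>2 / \<rho>\<^sup>2)" by (intro real_sqrt_le_mono) (simp add: power_divide)
  finally show ?thesis using assms unfolding equation_of_state_def by (smt (verit) add_divide_distrib)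
qed

text \<open>The derivative in the density is negative. This compensates for the limit of
  \<open>e\<close> being given at each fixed density: as the pressure tends to 0, a varying density
  can be replaced by a fixed smaller one.\<close>

lemma enthalpy_antimono:
  assumes "equation_of_state e" "p > 0" "0 < r" "r \<le> s"
  shows "enthalpy e p s \<le> enthalpy e p r"
proof (rule DERIV_nonpos_imp_nonincreasing[OF \<open>r \<le> s\<close>])
  fix x assume x: "r \<le> x" "x \<le> s"
  have "(\<lambda>(p, \<rho>). enthalpy e p \<rho>) differentiable at (p, x)"
    using assms x unfolding equation_of_state_def by auto
  then have "((\<lambda>(p, \<rho>). enthalpy e p \<rho>) \<circ> (\<lambda>\<rho>. (p, \<rho>))) differentiable at x"
    by (intro differentiable_chain_at differentiable_Pair) auto
  then have "(\<lambda>\<rho>. enthalpy e p \<rho>) differentiable at x" by (simp add: o_def)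
  then have "((\<lambda>\<rho>. enthalpy e p \<rho>) has_real_derivative deriv (\<lambda>\<rho>. enthalpy e p \<rho>) x) (at x)"
    by (simp add: DERIV_deriv_iff_real_differentiable)
  moreover have "deriv (\<lambda>\<rho>. enthalpy e p \<rho>) x < 0"
    using assms x unfolding equation_of_state_def by auto
  ultimately show "\<exists>y. ((\<lambda>\<rho>. enthalpy e p \<rho>) has_real_derivative y) (at x) \<and> y \<le> 0"
    by force
qed

lemma continuous_enthalpy:
  assumes "equation_of_state e"
  shows "continuous_on ({0<..} \<times> {0<..}) (\<lambda>(p, \<rho>). enthalpy e p \<rho>)"
  using assms unfolding equation_of_state_def
  by (intro continuous_at_imp_continuous_on) (auto intro!: differentiable_imp_continuous_within)

text \<open>\<open>Q\<close> stands for \<open>\<rho> h W\<^sup>2\<close>; the formula solves \<open>m = (Q + |B|\<^sup>2) v - (v \<bullet> B) B\<close> for \<open>v\<close>.\<close>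

definition velocity :: "real^3 \<Rightarrow> real^3 \<Rightarrow> real \<Rightarrow> real^3" where
  "velocity m B Q = (1 / (Q + (norm B)\<^sup>2)) *\<^sub>R (m + ((m \<bullet> B) / Q) *\<^sub>R B)"

lemma velocity_inner:
  assumes "Q > 0"
  shows "velocity m B Q \<bullet> B = (m \<bullet> B) / Q"
proof -
  have "Q + (norm B)\<^sup>2 > 0" using assms by (simp add: add_pos_nonneg)
  moreover have "(m + ((m \<bullet> B) / Q) *\<^sub>R B) \<bullet> B = (m \<bullet> B) / Q * (Q + (norm B)\<^sup>2)"
    using assms by (simp add: inner_simps power2_norm_eq_inner field_simps)
  ultimately show ?thesis unfolding velocity_def by simp
qed

lemma velocity_momentum:
  assumes "Q > 0"
  shows "(Q + (norm B)\<^sup>2) *\<^sub>R velocity m B Q - (velocity m B Q \<bullet> B) *\<^sub>R B = m"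
proof -
  have "Q + (norm B)\<^sup>2 > 0" using assms by (simp add: add_pos_nonneg)
  then show ?thesis unfolding velocity_inner[OF assms] by (simp add: velocity_def)
qed

lemma norm_velocity_sq:
  "(norm (velocity m B Q))\<^sup>2
   = ((norm m)\<^sup>2 + 2 * (m \<bullet> B)\<^sup>2 / Q + (m \<bullet> B)\<^sup>2 * (norm B)\<^sup>2 / Q\<^sup>2) / (Q + (norm B)\<^sup>2)\<^sup>2"
  unfolding power2_norm_eq_inner velocity_def
  by (simp add: inner_simps inner_commute power2_eq_square) 

text \<open>In \<open>norm_velocity_sq\<close> the variable occurs only in denominators, below
  nonnegative terms. Once below 1, the reconstructed speed therefore stays below 1 for larger
  \<open>Q\<close>.\<close>

lemma norm_velocity_antimono:
  assumes "0 < Q" "Q \<le> R"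
  shows "(norm (velocity m B R))\<^sup>2 \<le> (norm (velocity m B Q))\<^sup>2"
  unfolding norm_velocity_sq using assms
  by (intro frac_le add_mono divide_left_mono power_mono mult_pos_pos zero_less_power add_pos_nonneg
      add_nonneg_nonneg) auto

lemma norm_velocity_le:
  assumes "Q > 0"
  shows "norm (velocity m B Q) \<le> norm m / Q"
proof -
  have pos: "Q + (norm B)\<^sup>2 > 0" using assms by (simp add: add_pos_nonneg)
  have "norm (m + ((m \<bullet> B) / Q) *\<^sub>R B) \<le> norm m + norm (((m \<bullet> B) / Q) *\<^sub>R B)"
    by (rule norm_triangle_ineq)
  also have "norm (((m \<bullet> B) / Q) *\<^sub>R B) = \<bar>m \<bullet> B\<bar> * norm B / Q" using assms by simp
  also have "\<dots> \<le> (norm m * norm B) * norm B / Q"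
    using assms by (intro divide_right_mono mult_right_mono Cauchy_Schwarz_ineq2) auto
  also have "norm m + (norm m * norm B) * norm B / Q = norm m / Q * (Q + (norm B)\<^sup>2)"
    using assms by (simp add: field_simps power2_eq_square)
  finally have "norm (m + ((m \<bullet> B) / Q) *\<^sub>R B) \<le> norm m / Q * (Q + (norm B)\<^sup>2)" by simp
  moreover have "norm (velocity m B Q) = norm (m + ((m \<bullet> B) / Q) *\<^sub>R B) / (Q + (norm B)\<^sup>2)"
    using pos by (simp add: velocity_def del: scaleR_add_right)
  ultimately show ?thesis using pos by (simp add: pos_divide_le_eq)
qed

lemma continuous_velocity: "continuous_on {0<..} (velocity m B)"
  unfolding velocity_def
  by (intro continuous_intros) (auto dest: add_pos_nonneg[of _ "(norm B)\<^sup>2"])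

lemma mag_pressure_le:
  assumes "norm v < 1" shows "mag_pressure v B \<le> (norm B)\<^sup>2"
proof -
  have "(v \<bullet> B)\<^sup>2 \<le> (norm v)\<^sup>2 * (norm B)\<^sup>2"
    by (metis Cauchy_Schwarz_ineq power2_norm_eq_inner)
  then have "mag_pressure v B \<le> (norm B)\<^sup>2 / 2" unfolding mag_pressure_def by (simp add: algebra_simps)
  then show ?thesis by (smt (verit) field_sum_of_halves zero_le_power2)
qed

text \<open>With \<open>g = W\<^sup>-\<^sup>2\<close>, the fluid part of the estimate at \<open>v\<^sup>* = v(Q)\<close>, \<open>B\<^sup>* = B\<close> bounds the
  pressure \<open>p(Q)\<close> reconstructed from the energy.\<close>

lemma n_star_velocity:
  fixes D E :: real
  assumes "Q > 0" "norm (velocity m B Q) < 1"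
  defines "v \<equiv> velocity m B Q"
  defines "g \<equiv> 1 - (norm v)\<^sup>2" and "p \<equiv> Q + (norm B)\<^sup>2 - mag_pressure v B - E"
  shows "(D, m, B, E) \<bullet> n_star v B + mag_pressure v B = Q * g - D * sqrt g - p"
proof -
  have m: "m = (Q + (norm B)\<^sup>2) *\<^sub>R v - (v \<bullet> B) *\<^sub>R B"
    using velocity_momentum[OF assms(1), of B m] by (simp add: v_def)
  have "m \<bullet> v = (Q + (norm B)\<^sup>2) * (norm v)\<^sup>2 - (v \<bullet> B)\<^sup>2"
    by (subst m) (simp add: inner_simps inner_commute dot_square_norm, simp add: power2_eq_square)
  then have "(D, m, B, E) \<bullet> n_star v B = E - D * sqrt g - ((Q + (norm B)\<^sup>2) * (norm v)\<^sup>2 - (v \<bullet> B)\<^sup>2)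
      - g * (norm B)\<^sup>2 - (v \<bullet> B)\<^sup>2"
    by (simp add: n_star_def g_def inner_simps inner_commute dot_square_norm, simp add: power2_eq_square)
  then show ?thesis
    by (simp add: p_def g_def mag_pressure_def field_simps)
qed

text \<open>Momentum, energy and mass give velocity, pressure and density as functions
  \<open>V\<close>, \<open>P\<close>, \<open>r\<close> of the unknown \<open>Q\<close>. What is left
  is the scalar equation \<open>F Q = 0\<close>, to be solved where \<open>P Q\<close> and
  \<open>g Q\<close> are positive.\<close>

theorem admissible_if_n_star_pos:
  assumes eos: "equation_of_state e"
    and lim: "\<And>\<rho>. \<rho> > 0 \<Longrightarrow> ((\<lambda>p. e p \<rho>) \<longlongrightarrow> 0) (at_right 0)"
    and D_pos: "U \<bullet> n_one > 0"
    and pos: "\<And>v B. norm v < 1 \<Longrightarrow> U \<bullet> n_star v B + mag_pressure v B > 0"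
  shows "U \<in> admissible e"
proof -
  obtain D m B E where U: "U = (D, m, B, E)" by (metis prod_cases4)
  have D: "D > 0" using D_pos by (simp add: U n_one_def)
  define V where "V = velocity m B"
  define g where "g = (\<lambda>Q. 1 - (norm (V Q))\<^sup>2)"
  define P where "P = (\<lambda>Q. Q + (norm B)\<^sup>2 - mag_pressure (V Q) B - E)"
  have key: "P Q < Q * g Q - D * sqrt (g Q)" if "Q > 0" "norm (V Q) < 1" for Q
    using pos[OF that(2), of B] n_star_velocity[of Q m B D E] that
    unfolding U V_def g_def P_def by simp
  have contV: "continuous_on S V" if "S \<subseteq> {0<..}" for S
    using continuous_on_subset[OF continuous_velocity that] unfolding V_def .
  have contg: "continuous_on S g" if "S \<subseteq> {0<..}" for S
    unfolding g_def by (intro continuous_intros contV that)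
  have contP: "continuous_on S P" if "S \<subseteq> {0<..}" for S
    unfolding P_def mag_pressure_def by (intro continuous_intros contV that) auto
  have g_mono: "g Q \<le> g R" if "0 < Q" "Q \<le> R" for Q R
    using norm_velocity_antimono[OF that, of m B] unfolding g_def V_def by simp
  have g_pos: "g Q > 0 \<longleftrightarrow> norm (V Q) < 1" for Q
    unfolding g_def by (simp add: abs_square_less_1)
  \<comment> \<open>The search starts at a point with speed below 1 where the upper bound in
    \<open>key\<close> is negative, so that the pressure is negative there.\<close>
  obtain Q1 where Q1: "Q1 > 0" "g Q1 > 0" "Q1 * sqrt (g Q1) < D"
  proof (cases "\<forall>Q>0. g Q > 0")
    case True
    have "g (D / 2) \<le> 1" unfolding g_def by simp
    then have "D / 2 * sqrt (g (D / 2)) \<le> D / 2 * 1" using D by (intro mult_left_mono) auto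
    also have "\<dots> < D" using D by simp
    finally show thesis using that[of "D / 2"] True D by auto
  next
    case False
    then obtain Qz where Qz: "Qz > 0" "g Qz \<le> 0" by force
    \<comment> \<open>At \<open>Qm\<close> the speed is at most 1/2, so \<open>g\<close> rises from
      a nonpositive value at \<open>Qz\<close> to at least 1/2.\<close>
    define Qm where "Qm = max Qz (2 * norm m + 1)"
    have Qm: "Qm > 0" "Qm \<ge> Qz" "Qm \<ge> 2 * norm m" using Qz by (auto simp: Qm_def)
    have "norm (V Qm) \<le> norm m / Qm" unfolding V_def by (rule norm_velocity_le[OF Qm(1)])
    also have "\<dots> \<le> 1 / 2" using Qm by (simp add: field_simps)
    finally have "(norm (V Qm))\<^sup>2 \<le> (1 / 2)\<^sup>2" by (intro power_mono) auto
    then have gm: "g Qm \<ge> 1 / 2" unfolding g_def by (simp add: power2_eq_square)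
    \<comment> \<open>Small enough for \<open>Q * sqrt d \<le> D / 2\<close> at every positive
      \<open>Q \<le> Qm\<close>, and at most 1/2 so that \<open>g\<close> attains it.\<close>
    define d where "d = min (1 / 2) ((D / (2 * Qm))\<^sup>2)"
    have d: "d > 0" "d \<le> 1 / 2" "d \<le> (D / (2 * Qm))\<^sup>2" using D Qm by (auto simp: d_def)
    obtain Q where Q: "Qz \<le> Q" "Q \<le> Qm" "g Q = d"
      using IVT'[of g Qz d Qm] contg[of "{Qz..Qm}"] Qz Qm gm d by force
    have "sqrt d \<le> D / (2 * Qm)" using d(3) D Qm by (intro real_le_lsqrt) auto
    then have "Q * sqrt d \<le> Qm * (D / (2 * Qm))" using Q Qm Qz d by (intro mult_mono) auto
    also have "\<dots> < D" using D Qm by simp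
    finally show thesis using that[of Q] Q Qz d by auto
  qed
  have "P Q1 < sqrt (g Q1) * (Q1 * sqrt (g Q1) - D)"
    using key[OF Q1(1) iffD1[OF g_pos Q1(2)]] Q1(2) by (simp add: algebra_simps)
  also have "\<dots> \<le> 0" using Q1 by (intro mult_nonneg_nonpos) auto
  finally have PQ1: "P Q1 < 0" .
  have g1: "g Q > 0" if "Q \<ge> Q1" for Q using g_mono[of Q1 Q] Q1 that by linarith
  have PE: "P Q \<ge> Q - E" if "Q \<ge> Q1" for Q
    using mag_pressure_le[of "V Q" B] g1[OF that] unfolding P_def g_pos by simp
  \<comment> \<open>Far enough for positive pressure; moreover \<open>Q2 \<ge> 2 * E\<close> yields
    \<open>2 * P Q2 \<ge> Q2\<close>, from which \<open>F Q2 \<ge> 0\<close> follows by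
    \<open>enthalpy_ge\<close>.\<close>
  define Q2 where "Q2 = max Q1 (2 * \<bar>E\<bar> + 1)"
  have Q2: "Q2 \<ge> Q1" "P Q2 > 0" "Q2 \<ge> 2 * E" using PE[of Q2] by (auto simp: Q2_def)
  \<comment> \<open>The largest element \<open>Q0\<close> of \<open>A\<close> is the last zero of
    the pressure before \<open>Q2\<close>; from there up to \<open>Q2\<close> the pressure is
    positive.\<close>
  define A where "A = {Q \<in> {Q1..Q2}. P Q \<le> 0}"
  have "compact A"
  proof -
    have A: "A = {Q1..Q2} \<inter> P -` {..0}" by (auto simp: A_def)
    have "continuous_on {Q1..Q2} P" using Q1(1) by (intro contP) auto
    then have "closed A" unfolding A
      by (intro continuous_closed_preimage) auto
    then have "compact ({Q1..Q2} \<inter> A)" by (intro compact_Int_closed) auto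
    then show ?thesis unfolding A by (simp add: Int_left_absorb)
  qed
  moreover have "Q1 \<in> A" using Q2 PQ1 by (auto simp: A_def)
  ultimately obtain Q0 where Q0: "Q0 \<in> A" "\<And>Q. Q \<in> A \<Longrightarrow> Q \<le> Q0"
    using compact_attains_sup[of A] by blast
  have Q0': "Q1 \<le> Q0" "Q0 < Q2" "P Q0 \<le> 0" "Q0 > 0"
    using Q0(1) Q2 Q1 by (auto simp: A_def order.order_iff_strict)
  have P_pos: "P Q > 0" if "Q0 < Q" "Q \<le> Q2" for Q
    using Q0(2)[of Q] that Q0' by (force simp: A_def)
  have at: "isCont f Q0" if "continuous_on {0<..} f" for f :: "real \<Rightarrow> real"
    using that Q0' by (simp add: continuous_on_eq_continuous_at)
  have lims: "(f \<longlongrightarrow> f Q0) (at_right Q0)" if "continuous_on {0<..} f" for f :: "real \<Rightarrow> real"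
    using at[OF that] unfolding isCont_def by (rule filterlim_mono[OF _ order_refl at_le]) simp
  have near: "\<forall>\<^sub>F Q in at_right Q0. Q \<in> {Q0<..<Q2}" by (rule eventually_at_right_real[OF Q0'(2)])
  have "P Q0 \<ge> 0"
    using lims[OF contP[of "{0<..}"]] near
    by (intro tendsto_lowerbound[of P _ "at_right Q0"]) (auto elim!: eventually_mono intro!: less_imp_le[OF P_pos])
  then have P0: "P Q0 = 0" using Q0' by simp
  define r where "r = (\<lambda>Q. D * sqrt (g Q))"
  \<comment> \<open>Divided by \<open>g Q\<close>, the equation \<open>F Q = 0\<close> says that
    \<open>\<rho> h W\<^sup>2 = Q\<close> for the density \<open>r Q\<close>.\<close>
  define F where "F = (\<lambda>Q. r Q * enthalpy e (P Q) (r Q) - Q * g Q)"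
  have r_pos: "r Q > 0" if "Q \<ge> Q1" for Q using g1[OF that] D by (simp add: r_def)
  have "filterlim P (at_right 0) (at_right Q0)"
    unfolding filterlim_at
  proof
    show "(P \<longlongrightarrow> 0) (at_right Q0)" using lims[OF contP[of "{0<..}"]] P0 by simp
    show "\<forall>\<^sub>F Q in at_right Q0. P Q \<in> {0<..} \<and> P Q \<noteq> 0"
      using near by eventually_elim (use P_pos in force)
  qed
  then have e0: "((\<lambda>Q. e (P Q) (r Q0)) \<longlongrightarrow> 0) (at_right Q0)"
    using lim[OF r_pos[of Q0]] Q0' by (auto intro: filterlim_compose)
  \<comment> \<open>The density inside the enthalpy is frozen at \<open>r Q0\<close>, where the
    assumed limit of \<open>e\<close> applies. The resulting limit \<open>r Q0 - Q0 * g Q0\<close>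
    is negative by \<open>key\<close> at vanishing pressure.\<close>
  have "((\<lambda>Q. r Q * enthalpy e (P Q) (r Q0) - Q * g Q) \<longlongrightarrow> r Q0 * (1 + 0 + 0 / r Q0) - Q0 * g Q0) (at_right Q0)"
    unfolding enthalpy_def using r_pos[of Q0] Q0' P0
    by (intro tendsto_intros e0 lims[OF contg[of "{0<..}"]] lims[of r]
        lims[OF contP[of "{0<..}"], unfolded P0]) (auto simp: r_def intro!: continuous_intros contg)
  moreover have "r Q0 * (1 + 0 + 0 / r Q0) - Q0 * g Q0 < 0"
    using key[of Q0] Q0' g_pos[of Q0] g1[of Q0] P0 by (simp add: r_def)
  ultimately have "\<forall>\<^sub>F Q in at_right Q0. r Q * enthalpy e (P Q) (r Q0) - Q * g Q < 0"
    by (rule order_tendstoD)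
  with near have "\<forall>\<^sub>F Q in at_right Q0. Q \<in> {Q0<..<Q2} \<and> F Q < 0"
  proof eventually_elim
    case (elim Q)
    have "r Q0 \<le> r Q" using g_mono[of Q0 Q] elim Q0' D by (simp add: r_def)
    then have "enthalpy e (P Q) (r Q) \<le> enthalpy e (P Q) (r Q0)"
      using elim P_pos Q0' r_pos by (intro enthalpy_antimono[OF eos]) auto
    then have "r Q * enthalpy e (P Q) (r Q) \<le> r Q * enthalpy e (P Q) (r Q0)"
      using r_pos[of Q] elim Q0' by (intro mult_left_mono) auto
    then show ?case using elim unfolding F_def by auto
  qed
  then obtain Qa where Qa: "Q0 < Qa" "Qa < Q2" "F Qa < 0"
    using eventually_happens'[of "at_right Q0"] by auto
  have "r Q2 * enthalpy e (P Q2) (r Q2) \<ge> 2 * P Q2"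
    using enthalpy_ge[OF eos Q2(2) r_pos[OF Q2(1)]] r_pos[OF Q2(1)] by (simp add: field_simps)
  moreover have "Q2 * g Q2 \<le> Q2 * 1" using Q2 Q1 unfolding g_def by (intro mult_left_mono) auto
  ultimately have "F Q2 \<ge> 0" using PE[OF Q2(1)] Q2 unfolding F_def by linarith
  moreover have "continuous_on {Qa..Q2} F"
  proof -
    have "continuous_on {Qa..Q2} (\<lambda>Q. (P Q, r Q))"
      unfolding r_def using Qa Q0' by (intro continuous_intros contP contg) auto
    then have "continuous_on {Qa..Q2} ((\<lambda>(p, \<rho>). enthalpy e p \<rho>) \<circ> (\<lambda>Q. (P Q, r Q)))"
      using P_pos r_pos Qa Q0'
      by (intro continuous_on_compose continuous_on_subset[OF continuous_enthalpy[OF eos]]) auto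
    then show ?thesis unfolding F_def r_def using Qa Q0'
      by (intro continuous_intros contg) (auto simp: o_def r_def)
  qed
  ultimately obtain Q where Q: "Qa \<le> Q" "Q \<le> Q2" "F Q = 0"
    using IVT'[of F Qa 0 Q2] Qa by auto
  then have Q': "Q > 0" "norm (V Q) < 1" "P Q > 0" "r Q > 0" "Q \<ge> Q1"
    using Qa Q0' P_pos r_pos g1[of Q] g_pos by auto
  have W: "lorentz (V Q) = 1 / sqrt (g Q)" by (simp add: lorentz_def g_def)
  have "r Q * enthalpy e (P Q) (r Q) * (lorentz (V Q))\<^sup>2 = Q"
    using Q(3) g1[OF Q'(5)] unfolding F_def W by (simp add: power_divide)
  moreover have "r Q * lorentz (V Q) = D" using g1[OF Q'(5)] unfolding W r_def by simp
  ultimately have "U = conserved e (r Q) (V Q) B (P Q)"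
    using velocity_momentum[OF Q'(1), of B m]
    unfolding U conserved_def Let_def V_def[symmetric] by (simp add: P_def algebra_simps)
  then show ?thesis using Q' unfolding admissible_def by blast
qed

section \<open>Gauss nodes and polynomials of two variables\<close>

text \<open>The rule is applied to \<open>w\<close> times the squared product over the other nodes.
  The degree is at most \<open>2 * Q - 1\<close>, so the rule is exact, and only node
  \<open>\<mu>\<close> contributes. The choice \<open>w = 1\<close> gives positive weights.\<close>

lemma gauss_test_pos:
  assumes g: "gauss_rule Q gx gw" and \<mu>: "\<mu> \<in> {1..Q}"
    and w: "degree w \<le> 1" "w \<noteq> 0" "\<And>x. x \<in> {-1..1} \<Longrightarrow> poly w x \<ge> 0"
  shows "gw \<mu> * poly w (gx \<mu>) > 0"
proof -
  define l where "l = (\<Prod>\<nu>\<in>{1..Q} - {\<mu>}. [:- gx \<nu>, 1:])"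
  define f where "f = w * l\<^sup>2"
  have l: "poly l x = (\<Prod>\<nu>\<in>{1..Q} - {\<mu>}. x - gx \<nu>)" for x
    by (simp add: l_def poly_prod)
  have "l \<noteq> 0" by (simp add: l_def)
  then have f0: "f \<noteq> 0" using w by (simp add: f_def)
  have "degree l = Q - 1" using \<mu> unfolding l_def by (subst degree_prod_eq_sum_degree) auto
  then have "degree f \<le> 1 + 2 * (Q - 1)"
    using w(1) \<open>l \<noteq> 0\<close> w(2) by (simp add: f_def degree_mult_eq degree_power_eq)
  then have "degree f < 2 * Q" using \<mu> by auto
  then have "integral {-1..1} (poly f) / 2 = (\<Sum>\<nu>=1..Q. gw \<nu> * poly f (gx \<nu>))"
    using g unfolding gauss_rule_def by blast
  also have "\<dots> = gw \<mu> * poly f (gx \<mu>)"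
  proof (rule sum.remove[OF _ \<mu>, THEN trans])
    have "poly l (gx \<nu>) = 0" if "\<nu> \<in> {1..Q} - {\<mu>}" for \<nu>
      using that unfolding l by (intro prod_zero) auto
    then show "gw \<mu> * poly f (gx \<mu>) + (\<Sum>\<nu>\<in>{1..Q} - {\<mu>}. gw \<nu> * poly f (gx \<nu>)) = gw \<mu> * poly f (gx \<mu>)"
      by (simp add: f_def)
  qed simp
  finally have eq: "integral {-1..1} (poly f) / 2 = gw \<mu> * poly f (gx \<mu>)" .
  have nn: "poly f x \<ge> 0" if "x \<in> {-1..1}" for x using w(3)[OF that] by (simp add: f_def)
  have "\<not> (\<forall>x\<in>{-1..1}. poly f x = 0)"
  proof
    assume "\<forall>x\<in>{-1..1}. poly f x = 0"
    then have "{-1..1::real} \<subseteq> {x. poly f x = 0}" by auto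
    then have "finite {-1..1::real}" using poly_roots_finite[OF f0] finite_subset by blast
    then show False using infinite_Icc[of "-1::real" 1] by simp
  qed
  moreover have cont: "continuous_on {-1..1} (poly f)" by (intro continuous_intros)
  ultimately have "integral {-1..1} (poly f) \<noteq> 0"
    using integral_eq_0_iff[of "-1" 1 "poly f"] nn by auto
  moreover have "integral {-1..1} (poly f) \<ge> 0"
    using nn cont by (intro integral_nonneg integrable_continuous_interval) auto
  ultimately have "gw \<mu> * poly f (gx \<mu>) > 0" using eq by linarith
  then have "gw \<mu> * poly w (gx \<mu>) * (poly l (gx \<mu>))\<^sup>2 > 0" by (simp add: f_def mult.assoc)
  then show ?thesis using zero_le_power2[of "poly l (gx \<mu>)"]
    by (smt (verit) mult_nonpos_nonneg)
qed

lemma gauss_weight_pos: "gauss_rule Q gx gw \<Longrightarrow> \<mu> \<in> {1..Q} \<Longrightarrow> gw \<mu> > 0"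
  using gauss_test_pos[of Q gx gw \<mu> 1] by simp

text \<open>The test polynomials are \<open>1 + x\<close> and \<open>1 - x\<close>. Strictness keeps
  the flux points off the edges of the cells on which \<open>V\<close> is polynomial.\<close>

lemma gauss_node_interior:
  assumes "gauss_rule Q gx gw" "\<mu> \<in> {1..Q}"
  shows "-1 < gx \<mu>" "gx \<mu> < 1"
  using gauss_test_pos[OF assms, of "[:1, 1:]"] gauss_test_pos[OF assms, of "[:1, -1:]"]
    gauss_weight_pos[OF assms] by (simp_all add: zero_less_mult_iff)

section \<open>Polynomials in two variables of bounded total degree\<close>

lemma poly2_add:
  assumes "poly2_on k C f" "poly2_on k C g" shows "poly2_on k C (\<lambda>z. f z + g z)"
proof -
  obtain c d where "\<forall>(x, y)\<in>C. f (x, y) = (\<Sum>a\<le>k. \<Sum>b\<le>k - a. c a b * x ^ a * y ^ b)"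
    "\<forall>(x, y)\<in>C. g (x, y) = (\<Sum>a\<le>k. \<Sum>b\<le>k - a. d a b * x ^ a * y ^ b)"
    using assms unfolding poly2_on_def by blast
  then have "\<forall>(x, y)\<in>C. f (x, y) + g (x, y) = (\<Sum>a\<le>k. \<Sum>b\<le>k - a. (c a b + d a b) * x ^ a * y ^ b)"
    unfolding sum.distrib distrib_right by fastforce
  then show ?thesis unfolding poly2_on_def by (intro exI[of _ "\<lambda>a b. c a b + d a b"])
qed

lemma poly2_scale:
  assumes "poly2_on k C f" shows "poly2_on k C (\<lambda>z. r * f z)"
proof -
  obtain c where "\<forall>(x, y)\<in>C. f (x, y) = (\<Sum>a\<le>k. \<Sum>b\<le>k - a. c a b * x ^ a * y ^ b)"
    using assms unfolding poly2_on_def by blast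
  then have "\<forall>(x, y)\<in>C. r * f (x, y) = (\<Sum>a\<le>k. \<Sum>b\<le>k - a. (r * c a b) * x ^ a * y ^ b)"
    unfolding mult.assoc sum_distrib_left[symmetric] by fastforce
  then show ?thesis unfolding poly2_on_def by (intro exI[of _ "\<lambda>a b. r * c a b"])
qed

lemma poly2_monom:
  assumes "a + b \<le> k" shows "poly2_on k C (\<lambda>z. fst z ^ a * snd z ^ b)"
proof -
  have "(\<Sum>i\<le>k. \<Sum>j\<le>k - i. (if i = a then if j = b then 1 else 0 else 0) * x ^ i * y ^ j) = x ^ a * y ^ b"
    for x y :: real
  proof -
    have "(\<Sum>i\<le>k. \<Sum>j\<le>k - i. (if i = a then if j = b then 1 else 0 else 0) * x ^ i * y ^ j)
        = (\<Sum>i\<le>k. if i = a then \<Sum>j\<le>k - i. if j = b then x ^ i * y ^ j else 0 else 0)"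
      by (intro sum.cong refl) (auto intro!: sum.cong simp del: sum.delta sum.delta')
    also have "\<dots> = (\<Sum>j\<le>k - a. if j = b then x ^ a * y ^ j else 0)"
      using assms by (subst sum.delta) auto
    also have "\<dots> = x ^ a * y ^ b" using assms by (subst sum.delta) auto
    finally show ?thesis .
  qed
  then show ?thesis unfolding poly2_on_def
    by (intro exI[of _ "\<lambda>i j. if i = a then if j = b then 1 else 0 else 0"]) simp
qed

lemma poly2_const: "poly2_on k C (\<lambda>z. r)"
  using poly2_scale[OF poly2_monom[of 0 0 k C], of r] by simp

lemma poly2_sum:
  assumes "\<And>i. i \<in> I \<Longrightarrow> poly2_on k C (f i)" shows "poly2_on k C (\<lambda>z. \<Sum>i\<in>I. f i z)"
  using assms by (induction I rule: infinite_finite_induct) (auto intro: poly2_const poly2_add)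

text \<open>Binomial expansion produces only monomials with \<open>i + j \<le> a + b\<close>, so the
  total degree does not grow. This transports the decomposition from the reference square to a
  quarter cell.\<close>

lemma poly2_affine:
  assumes "poly2_on k UNIV f"
  shows "poly2_on k UNIV (\<lambda>z. f (p + r * fst z, q + s * snd z))"
proof -
  obtain c where c: "\<And>x y. f (x, y) = (\<Sum>a\<le>k. \<Sum>b\<le>k - a. c a b * x ^ a * y ^ b)"
    using assms unfolding poly2_on_def by auto
  have "f (p + r * x, q + s * y) = (\<Sum>a\<le>k. \<Sum>b\<le>k - a. \<Sum>i\<le>a. \<Sum>j\<le>b.
      (c a b * real (a choose i) * real (b choose j) * r ^ i * p ^ (a - i) * s ^ j * q ^ (b - j)) * (x ^ i * y ^ j))"
    for x y
    unfolding c add.commute[of p] add.commute[of q] binomial_ring mult.assoc sum_product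
    unfolding sum_distrib_left by (intro sum.cong refl) (simp add: power_mult_distrib mult_ac)
  then show ?thesis
    by simp (intro poly2_sum poly2_scale poly2_monom, auto)
qed

lemma poly2_continuous:
  assumes "poly2_on k UNIV f" shows "continuous_on S f"
proof -
  obtain c where c: "\<And>x y. f (x, y) = (\<Sum>a\<le>k. \<Sum>b\<le>k - a. c a b * x ^ a * y ^ b)"
    using assms unfolding poly2_on_def by auto
  then have "f = (\<lambda>z. \<Sum>a\<le>k. \<Sum>b\<le>k - a. c a b * fst z ^ a * snd z ^ b)" by (auto simp: fun_eq_iff)
  then show ?thesis by (simp only:) (intro continuous_intros)
qed

text \<open>Edge values of \<open>V\<close> are arbitrary; limits and integrals are therefore taken
  of a polynomial on the whole plane, assembled from the components along
  \<open>Basis\<close>.\<close>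

lemma dg_space_polynomial:
  assumes "V \<in> dg_space k \<C>" "C \<in> \<C>"
  obtains P where "\<And>z. z \<in> C \<Longrightarrow> V z = P z" "\<And>n. poly2_on k UNIV (\<lambda>z. P z \<bullet> n)"
    "\<And>S. continuous_on S P"
proof -
  have "\<exists>f. poly2_on k UNIV f \<and> (\<forall>z\<in>C. V z \<bullet> b = f z)" if "b \<in> Basis" for b
  proof -
    have "poly2_on k C (\<lambda>z. V z \<bullet> b)" using assms that unfolding dg_space_def by auto
    then obtain c where c: "\<forall>(x, y)\<in>C. V (x, y) \<bullet> b = (\<Sum>i\<le>k. \<Sum>j\<le>k - i. c i j * x ^ i * y ^ j)"
      unfolding poly2_on_def by blast
    then show ?thesis unfolding poly2_on_def
      by (intro exI[of _ "\<lambda>(x, y). \<Sum>i\<le>k. \<Sum>j\<le>k - i. c i j * x ^ i * y ^ j"]) auto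
  qed
  then obtain f where "\<forall>b\<in>Basis. poly2_on k UNIV (f b) \<and> (\<forall>z\<in>C. V z \<bullet> b = f b z)"
    using bchoice[of Basis "\<lambda>b f. poly2_on k UNIV f \<and> (\<forall>z\<in>C. V z \<bullet> b = f z)"] by blast
  then have f: "\<And>b. b \<in> Basis \<Longrightarrow> poly2_on k UNIV (f b)"
    "\<And>b z. b \<in> Basis \<Longrightarrow> z \<in> C \<Longrightarrow> V z \<bullet> b = f b z"
    by auto
  define P :: "real \<times> real \<Rightarrow> state" where "P = (\<lambda>z. \<Sum>b\<in>Basis. f b z *\<^sub>R b)"
  show thesis
  proof (rule that[of P])
    show "V z = P z" if "z \<in> C" for z
    proof -
      have "V z = (\<Sum>b\<in>Basis. (V z \<bullet> b) *\<^sub>R b)" by (simp add: euclidean_representation)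
      also have "\<dots> = P z" unfolding P_def using f(2)[OF _ that] by (intro sum.cong) simp_all
      finally show ?thesis .
    qed
    show "poly2_on k UNIV (\<lambda>z. P z \<bullet> n)" for n
      unfolding P_def inner_sum_left inner_scaleR_left mult.commute[of "f _ _"]
      by (intro poly2_sum poly2_scale f)
    show "continuous_on S P" for S
      unfolding P_def by (intro continuous_intros poly2_continuous[OF f(1)])
  qed
qed

section \<open>Affine change of variables on rectangles\<close>

lemma image_affine_interval:
  fixes c h :: real
  assumes "h > 0"
  shows "(\<lambda>x. c + h * x) ` {a..b} = {c + h * a..c + h * b}"
    "(\<lambda>x. (x - c) / h) ` {a..b} = {(a - c) / h..(b - c) / h}"
proof -
  have image: "f ` S = g -` S" if "\<And>x. f (g x) = x" "\<And>x. g (f x) = x" for f g :: "real \<Rightarrow> real" and S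
    using that by (auto simp: image_iff) metis
  have inv: "c + h * ((x - c) / h) = x" "(c + h * x - c) / h = x" for x using assms by auto
  have "(\<lambda>x. c + h * x) ` {a..b} = (\<lambda>x. (x - c) / h) -` {a..b}"
    "(\<lambda>x. (x - c) / h) ` {a..b} = (\<lambda>x. c + h * x) -` {a..b}"
    using inv by (intro image; simp)+
  then show "(\<lambda>x. c + h * x) ` {a..b} = {c + h * a..c + h * b}"
    "(\<lambda>x. (x - c) / h) ` {a..b} = {(a - c) / h..(b - c) / h}"
    using assms by (auto simp: vimage_def field_simps)
qed

text \<open>The substitution is done on closed boxes, with Jacobian \<open>h * l\<close>; the
  frontier is negligible, which gives the open rectangle.\<close>

lemma has_integral_affine_rectangle:
  fixes f :: "real \<times> real \<Rightarrow> 'a :: banach"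
  assumes h: "h > 0" "l > 0" and f: "continuous_on UNIV f"
  shows "(f has_integral (h * l) *\<^sub>R integral ({-1..1} \<times> {-1..1}) (\<lambda>z. f (c + h * fst z, d + l * snd z)))
    ({c - h<..<c + h} \<times> {d - l<..<d + l})"
proof -
  let ?F = "\<lambda>z. f (c + h * fst z, d + l * snd z)"
  let ?to = "\<lambda>z. (c + h * fst z, d + l * snd z)" and ?from = "\<lambda>z. ((fst z - c) / h, (snd z - d) / l)"
  have box: "cbox (p, q) (r, s) = {p..r} \<times> {q..s}" for p q r s :: real by (simp add: cbox_Pair_eq)
  have to: "?to ` cbox (p, q) (r, s) = cbox (c + h * p, d + l * q) (c + h * r, d + l * s)" for p q r s
  proof -
    have "?to ` ({p..r} \<times> {q..s}) = (\<lambda>x. c + h * x) ` {p..r} \<times> (\<lambda>y. d + l * y) ` {q..s}"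
      by force
    then show ?thesis unfolding box image_affine_interval(1)[OF h(1)] image_affine_interval(1)[OF h(2)] .
  qed
  have from': "?from ` cbox (p, q) (r, s) = cbox ((p - c) / h, (q - d) / l) ((r - c) / h, (s - d) / l)" for p q r s
  proof -
    have "?from ` ({p..r} \<times> {q..s}) = (\<lambda>x. (x - c) / h) ` {p..r} \<times> (\<lambda>y. (y - d) / l) ` {q..s}"
      by force
    then show ?thesis unfolding box image_affine_interval(2)[OF h(1)] image_affine_interval(2)[OF h(2)] .
  qed
  have F: "(?F has_integral integral (cbox (-1, -1) (1, 1)) ?F) (cbox (-1, -1) (1, 1))"
    by (intro integrable_integral integrable_continuous continuous_on_compose2[OF f] continuous_intros) auto
  have "((\<lambda>x. ?F (?from x)) has_integral (1 / (1 / (h * l))) *\<^sub>R integral (cbox (-1, -1) (1, 1)) ?F)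
      (?to ` cbox (-1, -1) (1, 1))"
  proof (rule has_integral_twiddle[OF _ _ _ _ _ _ _ F])
    show "\<exists>w z. ?from ` cbox u v = cbox w z" for u v using from'[of "fst u" "snd u" "fst v" "snd v"] by auto
    show "\<exists>w z. ?to ` cbox u v = cbox w z" for u v using to[of "fst u" "snd u" "fst v" "snd v"] by auto
    show "measure lborel (?from ` cbox u v) = 1 / (h * l) * measure lborel (cbox u v)" for u v
    proof (cases u; cases v)
      fix p q r s assume uv: "u = (p, q)" "v = (r, s)"
      show ?thesis unfolding uv from' content_Pair using h
        by (simp add: content_real_if divide_le_cancel) (simp add: field_simps)
    qed
    show "continuous (at x) ?from" for x
    proof -
      have "continuous_on UNIV ?from" by (intro continuous_intros) (use h in auto)
      then show ?thesis using continuous_on_eq_continuous_at[of UNIV ?from] by blast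
    qed
  qed (use h in auto)
  moreover have "(\<lambda>x. ?F (?from x)) = f" using h by (auto simp: fun_eq_iff)
  ultimately have "(f has_integral (h * l) *\<^sub>R integral (cbox (-1, -1) (1, 1)) ?F) (cbox (c - h, d - l) (c + h, d + l))"
    using to[of "-1" "-1" 1 1] by simp
  then have "(f has_integral (h * l) *\<^sub>R integral (cbox (-1, -1) (1, 1)) ?F) (interior (cbox (c - h, d - l) (c + h, d + l)))"
    by (subst has_integral_interior) (auto intro: negligible_convex_frontier)
  then show ?thesis unfolding box interior_Times by (simp add: interior_atLeastAtMost_real)
qed

section \<open>Cell averages\<close>

text \<open>Quarter cells lie in a cell of either mesh, so a solution on the other mesh is a single
  polynomial on each of them.\<close>

lemma quarter_cell_subset:
  assumes "dx M > 0" "dy M > 0" "m \<in> {-1, 1}" "\<sigma> \<in> {-1, 1}"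
  shows "quarter_cell M (a + m / 4) (b + \<sigma> / 4) \<subseteq> cell M a b \<inter> cell M (a + m / 2) (b + \<sigma> / 2)"
  using assms by (auto simp: quarter_cell_def cell_def xpt_def ypt_def field_simps)

text \<open>The four quarters fill the cell up to its two center lines, which are negligible. Each
  Jacobian \<open>dx M / 4 * (dy M / 4)\<close>, divided by the cell area, leaves 1/16.\<close>

lemma cell_avg_quarters:
  assumes mesh: "dx M > 0" "dy M > 0"
    and cont: "\<And>m \<sigma>. m \<in> {-1, 1} \<Longrightarrow> \<sigma> \<in> {-1, 1} \<Longrightarrow> continuous_on UNIV (P m \<sigma>)"
    and V: "\<And>m \<sigma> z. m \<in> {-1, 1} \<Longrightarrow> \<sigma> \<in> {-1, 1} \<Longrightarrow>
      z \<in> quarter_cell M (a + m / 4) (b + \<sigma> / 4) \<Longrightarrow> V z = P m \<sigma> z"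
  shows "cell_avg M V a b = (1 / 16) *\<^sub>R (\<Sum>m\<in>{-1, 1}. \<Sum>\<sigma>\<in>{-1, 1}.
    integral ({-1..1} \<times> {-1..1}) (\<lambda>z. P m \<sigma> (xpt M (a + m / 4) + dx M / 4 * fst z, ypt M (b + \<sigma> / 4) + dy M / 4 * snd z)))"
proof -
  define I where "I = (\<lambda>(m, \<sigma>). integral ({-1..1} \<times> {-1..1})
    (\<lambda>z. P m \<sigma> (xpt M (a + m / 4) + dx M / 4 * fst z, ypt M (b + \<sigma> / 4) + dy M / 4 * snd z)))"
  let ?N = "{-1, 1} \<times> {-1, 1} :: (real \<times> real) set"
  define T where "T = (\<lambda>(m, \<sigma>). quarter_cell M (a + m / 4) (b + \<sigma> / 4))"
  have quarter: "(V has_integral (dx M / 4 * (dy M / 4)) *\<^sub>R I i) (T i)" if i: "i \<in> ?N" for i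
  proof -
    obtain m \<sigma> where ms: "i = (m, \<sigma>)" "m \<in> {-1, 1}" "\<sigma> \<in> {-1, 1}" using i by auto
    have "(P m \<sigma> has_integral (dx M / 4 * (dy M / 4)) *\<^sub>R I i) (T i)"
      unfolding ms I_def T_def prod.case quarter_cell_def using mesh
      by (intro has_integral_affine_rectangle cont ms) auto
    then show ?thesis
      by (rule has_integral_eq[rotated]) (use V ms in \<open>auto simp: T_def\<close>)
  qed
  have "(V has_integral (\<Sum>i\<in>?N. (dx M / 4 * (dy M / 4)) *\<^sub>R I i)) (\<Union>i\<in>?N. T i)"
  proof (rule has_integral_UN[OF _ quarter])
    show "pairwise (\<lambda>i j. negligible (T i \<inter> T j)) ?N"
    proof (rule pairwiseI)
      fix i j assume "i \<in> ?N" "j \<in> ?N" "i \<noteq> j"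
      then have "T i \<inter> T j = {}"
        using mesh by (auto simp: T_def quarter_cell_def xpt_def ypt_def field_simps)
      then show "negligible (T i \<inter> T j)" by simp
    qed
  qed auto
  moreover have "(V has_integral y) (\<Union>i\<in>?N. T i) \<longleftrightarrow> (V has_integral y) (cell M a b)" for y
  proof (rule has_integral_spike_set_eq)
    have "(\<Union>i\<in>?N. T i) - cell M a b = {}"
      using quarter_cell_subset[OF mesh] unfolding T_def by blast
    then have "{x \<in> (\<Union>i\<in>?N. T i) - cell M a b. V x \<noteq> 0} = {}" by blast
    then show "negligible {x \<in> (\<Union>i\<in>?N. T i) - cell M a b. V x \<noteq> 0}" by (simp only: negligible_empty)
    have "{x \<in> cell M a b - (\<Union>i\<in>?N. T i). V x \<noteq> 0}
        \<subseteq> {z. z \<bullet> (1, 0) = xpt M a} \<union> {z. z \<bullet> (0, 1) = ypt M b}"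
      using mesh by (auto simp: T_def quarter_cell_def cell_def xpt_def ypt_def field_simps)
    moreover have "negligible ({z :: real \<times> real. z \<bullet> (1, 0) = xpt M a} \<union> {z. z \<bullet> (0, 1) = ypt M b})"
      by (intro negligible_Un negligible_standard_hyperplane) (auto simp: Basis_prod_def)
    ultimately show "negligible {x \<in> cell M a b - (\<Union>i\<in>?N. T i). V x \<noteq> 0}"
      using negligible_subset by blast
  qed
  ultimately have "integral (cell M a b) V = (\<Sum>i\<in>?N. (dx M / 4 * (dy M / 4)) *\<^sub>R I i)"
    by (intro integral_unique) blast
  also have "\<dots> = (dx M * dy M / 16) *\<^sub>R (\<Sum>m\<in>{-1, 1}. \<Sum>\<sigma>\<in>{-1, 1}. I (m, \<sigma>))"
    by (simp add: sum.cartesian_product scaleR_sum_right[symmetric])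
  finally show ?thesis using mesh by (simp add: cell_avg_def I_def)
qed

text \<open>Every point of the closed rectangle is a limit point of its interior, so the limit of
  \<open>V\<close> is unique and equals the value of the continuous extension
  \<open>P\<close>.\<close>

lemma quarter_trace_continuous:
  assumes mesh: "dx M > 0" "dy M > 0"
    and P: "continuous_on UNIV P" "\<And>z. z \<in> quarter_cell M a b \<Longrightarrow> V z = P z"
    and st: "s \<in> {-1..1}" "t \<in> {-1..1}"
    and z: "z = (xpt M a + s * dx M / 4, ypt M b + t * dy M / 4)"
  shows "quarter_trace M a b V z = P z"
proof -
  have op: "open (quarter_cell M a b)" unfolding quarter_cell_def by (intro open_Times) auto
  have "closure (quarter_cell M a b)
      = {xpt M a - dx M / 4..xpt M a + dx M / 4} \<times> {ypt M b - dy M / 4..ypt M b + dy M / 4}"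
    unfolding quarter_cell_def closure_Times using mesh by simp
  moreover have "\<bar>s * dx M\<bar> \<le> 1 * dx M" "\<bar>t * dy M\<bar> \<le> 1 * dy M"
    unfolding abs_mult using mesh st by (intro mult_mono; auto)+
  ultimately have "z \<in> closure (quarter_cell M a b)"
    unfolding z by auto
  then have "z islimpt quarter_cell M a b"
    using interior_limit_point[of z "quarter_cell M a b"] op by (auto simp: closure_def interior_open)
  then have "at z within quarter_cell M a b \<noteq> bot" by (simp add: trivial_limit_within)
  moreover have "(P \<longlongrightarrow> P z) (at z within quarter_cell M a b)"
    using P(1) by (metis UNIV_I continuous_on_def continuous_on_subset subset_UNIV tendsto_within_subset)
  then have "(V \<longlongrightarrow> P z) (at z within quarter_cell M a b)"
    by (rule Lim_transform_eventually) (auto simp: eventually_at_filter P(2))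
  ultimately show ?thesis unfolding quarter_trace_def by (intro tendsto_Lim)
qed

section \<open>The estimate for one updated average\<close>

text \<open>The functional \<open>X \<bullet> n + c\<close> with the flux corrections \<open>\<gamma>\<close>, \<open>\<kappa>\<close> stands for both \<open>n\<^sub>1\<close>
  (\<open>c = 0\<close>, \<open>\<gamma> = 0\<close>, \<open>\<kappa> = 0\<close>) and \<open>n\<^sup>*\<close> (\<open>c = p\<^sub>m\<^sup>*\<close>, \<open>\<gamma> i = v\<^sub>i\<^sup>* p\<^sub>m\<^sup>*\<close>, \<open>\<kappa> = v\<^sup>* \<bullet> B\<^sup>*\<close>).\<close>

lemma updated_avg_bound:
  fixes \<gamma> :: "3 \<Rightarrow> real"
  assumes mesh: "dx M > 0" "dy M > 0"
    and gauss: "gauss_rule (k + 1) gx gw"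
    and V: "V \<in> dg_space k \<C>" "\<And>m \<sigma>. m \<in> {-1, 1} \<Longrightarrow> \<sigma> \<in> {-1, 1} \<Longrightarrow> cell M (a + m / 2) (b + \<sigma> / 2) \<in> \<C>"
    and cad: "cad k gx gw (1 / dx M) (1 / dy M) wbar S wt xt yt"
    and nodes: "\<And>m \<sigma> z. m \<in> {-1, 1} \<Longrightarrow> \<sigma> \<in> {-1, 1} \<Longrightarrow>
        z \<in> quarter_nodes M (k + 1) gx S xt yt (a + m / 4) (b + \<sigma> / 4) \<Longrightarrow>
        quarter_trace M (a + m / 4) (b + \<sigma> / 4) V z \<in> G"
    and theta: "\<theta> = dt / \<tau>" "0 < \<theta>" "\<theta> \<le> 1"
    and cfl: "0 < dt * (1 / dx M + 1 / dy M)" "dt * (1 / dx M + 1 / dy M) \<le> \<theta> * wbar / 2"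
    and pos: "\<And>X. X \<in> G \<Longrightarrow> X \<bullet> n + c > 0"
    and fl: "\<And>X s i. X \<in> G \<Longrightarrow> \<bar>s\<bar> = 1 \<Longrightarrow>
        X \<bullet> n + c - s * (flux e i X \<bullet> n + \<gamma> i - \<kappa> * magnetic X $ i) \<ge> 0"
    and avgU: "cell_avg M U a b \<bullet> n + c > 0"
  shows "updated_avg e M (k + 1) gx gw \<tau> dt U V a b \<bullet> n + c
    > - dt * \<kappa> * discrete_div M (k + 1) gx gw V a b"
proof -
  \<comment> \<open>This keeps the simplifier from splitting off the last summand of sums up to
    \<open>k + 1\<close>.\<close>
  note sum.cl_ivl_Suc [simp del]
  define A where "A = (\<lambda>X. X \<bullet> n + c)"
  define l where "l = 1 / dx M + 1 / dy M"
  define \<alpha> \<beta> where "\<alpha> = 1 / dx M / l" and "\<beta> = 1 / dy M / l"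
  let ?K = "{1..k + 1}"
  have l: "l > 0" using mesh by (simp add: l_def add_pos_pos)
  have ab: "\<alpha> > 0" "\<beta> > 0" using mesh l by (simp_all add: \<alpha>_def \<beta>_def)
  have dt: "dt > 0" using cfl(1) l by (simp add: l_def[symmetric] zero_less_mult_iff)
  have gw: "gw \<mu> > 0" "-1 < gx \<mu>" "gx \<mu> < 1" if "\<mu> \<in> ?K" for \<mu>
    using gauss_weight_pos[OF gauss that] gauss_node_interior[OF gauss that] by auto
  have wbar: "wbar > 0" using cad by (simp add: cad_def)
  have wt: "wt s \<ge> 0" "xt s \<in> {-1..1}" "yt s \<in> {-1..1}" if "s \<in> {1..S}" for s
    using cad that by (auto simp: cad_def)

  have "\<exists>P. (\<forall>z\<in>cell M (a + m / 2) (b + \<sigma> / 2). V z = P z) \<and> (\<forall>n. poly2_on k UNIV (\<lambda>z. P z \<bullet> n)) \<and>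
      continuous_on UNIV P" if "m \<in> {-1, 1}" "\<sigma> \<in> {-1, 1}" for m \<sigma>
    by (rule dg_space_polynomial[OF V(1) V(2)[OF that]]) blast
  then obtain P where P: "\<And>m \<sigma> z. m \<in> {-1, 1} \<Longrightarrow> \<sigma> \<in> {-1, 1} \<Longrightarrow>
      z \<in> cell M (a + m / 2) (b + \<sigma> / 2) \<Longrightarrow> V z = P m \<sigma> z"
    "\<And>m \<sigma> n. m \<in> {-1, 1} \<Longrightarrow> \<sigma> \<in> {-1, 1} \<Longrightarrow> poly2_on k UNIV (\<lambda>z. P m \<sigma> z \<bullet> n)"
    "\<And>m \<sigma>. m \<in> {-1, 1} \<Longrightarrow> \<sigma> \<in> {-1, 1} \<Longrightarrow> continuous_on UNIV (P m \<sigma>)"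
    by metis
  have PV: "V z = P m \<sigma> z"
    if "m \<in> {-1, 1}" "\<sigma> \<in> {-1, 1}" "z \<in> quarter_cell M (a + m / 4) (b + \<sigma> / 4)" for m \<sigma> z
    using P(1)[OF that(1,2)] quarter_cell_subset[OF mesh that(1,2)] that(3) by blast
  \<comment> \<open>\<open>q m \<sigma>\<close> is the polynomial of a quarter cell pulled back to
    the reference square.\<close>
  define q where "q = (\<lambda>m \<sigma> s t. P m \<sigma> (xpt M (a + m / 4) + dx M / 4 * s, ypt M (b + \<sigma> / 4) + dy M / 4 * t))"
  have qG: "q m \<sigma> s t \<in> G"
    if ms: "m \<in> {-1, 1}" "\<sigma> \<in> {-1, 1}" and st: "s \<in> {-1..1}" "t \<in> {-1..1}" and
      "s \<in> {-1, 1} \<and> (\<exists>\<mu>\<in>?K. t = gx \<mu>) \<or> t \<in> {-1, 1} \<and> (\<exists>\<mu>\<in>?K. s = gx \<mu>) \<or> (\<exists>i\<in>{1..S}. s = xt i \<and> t = yt i)"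
    for m \<sigma> s t
  proof -
    let ?z = "(xpt M (a + m / 4) + s * dx M / 4, ypt M (b + \<sigma> / 4) + t * dy M / 4)"
    have "?z \<in> quarter_nodes M (k + 1) gx S xt yt (a + m / 4) (b + \<sigma> / 4)"
      using that(5) unfolding quarter_nodes_def xgauss_def ygauss_def by blast
    then have "quarter_trace M (a + m / 4) (b + \<sigma> / 4) V ?z \<in> G" by (rule nodes[OF ms])
    also have "quarter_trace M (a + m / 4) (b + \<sigma> / 4) V ?z = P m \<sigma> ?z"
      by (rule quarter_trace_continuous[OF mesh P(3)[OF ms] PV[OF ms] st refl])
    finally show ?thesis by (simp add: q_def mult.commute)
  qed
  have Apos: "A X > 0" if "X \<in> G" for X using pos[OF that] by (simp add: A_def)

  define K where "K = (\<lambda>m \<sigma>. wbar * (\<Sum>\<mu>=1..k+1. gw \<mu> *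
      (\<alpha> * (A (q m \<sigma> (-1) (gx \<mu>)) + A (q m \<sigma> 1 (gx \<mu>))) + \<beta> * (A (q m \<sigma> (gx \<mu>) (-1)) + A (q m \<sigma> (gx \<mu>) 1))))
      + (\<Sum>s=1..S. wt s * A (q m \<sigma> (xt s) (yt s))))"
  \<comment> \<open>The decomposition is applied to the polynomial
    \<open>?q z \<bullet> n + c\<close>, so the constant \<open>c\<close> passes through it.\<close>
  have quarter: "integral ({-1..1} \<times> {-1..1}) (\<lambda>z. q m \<sigma> (fst z) (snd z)) \<bullet> n / 4 + c = K m \<sigma>"
    if ms: "m \<in> {-1, 1}" "\<sigma> \<in> {-1, 1}" for m \<sigma>
  proof -
    let ?B = "{-1..1} \<times> {-1..1} :: (real \<times> real) set"
    let ?q = "\<lambda>z. q m \<sigma> (fst z) (snd z)"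
    have B: "?B = cbox (-1, -1) (1, 1)" by (simp add: cbox_Pair_eq)
    have "continuous_on ?B ?q"
      unfolding q_def by (intro continuous_on_compose2[OF P(3)[OF ms]] continuous_intros) auto
    then have int: "?q integrable_on ?B" unfolding B by (rule integrable_continuous)
    have "((\<lambda>z. ?q z \<bullet> n + c) has_integral integral ?B ?q \<bullet> n + measure lborel ?B *\<^sub>R c) ?B"
      using has_integral_linear[OF integrable_integral[OF int] bounded_linear_inner_left[of n]]
      unfolding B by (intro has_integral_add has_integral_const) (simp add: o_def)
    moreover have "measure lborel ?B = 4" unfolding B content_Pair by simp
    ultimately have "integral ?B (\<lambda>z. ?q z \<bullet> n + c) = integral ?B ?q \<bullet> n + 4 * c"
      by (simp add: integral_unique)
    moreover have "poly2_on k UNIV (\<lambda>z. ?q z \<bullet> n + c)"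
      unfolding q_def by (intro poly2_add poly2_const poly2_affine[of k "\<lambda>z. P m \<sigma> z \<bullet> n"] P(2)[OF ms])
    then have "integral ?B (\<lambda>z. ?q z \<bullet> n + c) / 4 = K m \<sigma>"
      using cad unfolding cad_def K_def A_def \<alpha>_def \<beta>_def l_def by (elim conjE allE) (drule (1) mp, simp)
    ultimately show ?thesis by simp
  qed
  have avgV: "A (cell_avg M V a b) = (1 / 4) * (K 1 1 + K 1 (-1) + K (-1) 1 + K (-1) (-1))"
  proof -
    have "cell_avg M V a b = (1 / 16) *\<^sub>R (\<Sum>m\<in>{-1, 1}. \<Sum>\<sigma>\<in>{-1, 1}.
        integral ({-1..1} \<times> {-1..1}) (\<lambda>z. q m \<sigma> (fst z) (snd z)))"
      unfolding q_def by (rule cell_avg_quarters[OF mesh P(3) PV])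
    then have "A (cell_avg M V a b) = (\<Sum>m\<in>{-1, 1}. \<Sum>\<sigma>\<in>{-1, 1}.
        integral ({-1..1} \<times> {-1..1}) (\<lambda>z. q m \<sigma> (fst z) (snd z)) \<bullet> n) / 16 + c"
      by (simp add: A_def inner_add_left)
    then show ?thesis by (simp add: quarter[symmetric] field_simps)
  qed

  \<comment> \<open>\<open>X\<close> and \<open>Y\<close> are the values of \<open>V\<close> on the
    vertical and horizontal sides of the cell; in each quarter they lie on the two outer
    sides.\<close>
  define X where "X = (\<lambda>m \<sigma> \<mu>. V (xpt M (a + m / 2), ygauss M gx (b + \<sigma> / 4) \<mu>))"
  define Y where "Y = (\<lambda>m \<sigma> \<mu>. V (xgauss M gx (a + m / 4) \<mu>, ypt M (b + \<sigma> / 2)))"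
  have XY: "X m \<sigma> \<mu> = q m \<sigma> m (gx \<mu>)" "Y m \<sigma> \<mu> = q m \<sigma> (gx \<mu>) \<sigma>" "X m \<sigma> \<mu> \<in> G" "Y m \<sigma> \<mu> \<in> G"
    if ms: "m \<in> {-1, 1}" "\<sigma> \<in> {-1, 1}" and \<mu>: "\<mu> \<in> ?K" for m \<sigma> \<mu>
  proof -
    have x: "(xpt M (a + m / 2), ygauss M gx (b + \<sigma> / 4) \<mu>) \<in> cell M (a + m / 2) (b + \<sigma> / 2)"
      and y: "(xgauss M gx (a + m / 4) \<mu>, ypt M (b + \<sigma> / 2)) \<in> cell M (a + m / 2) (b + \<sigma> / 2)"
    proof -
      define u w where uw: "u = gx \<mu> * dx M" "w = gx \<mu> * dy M"
      have "-1 * dx M < u" "u < 1 * dx M" "-1 * dy M < w" "w < 1 * dy M"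
        unfolding uw using gw(2,3)[OF \<mu>] mesh by (intro mult_strict_right_mono; simp)+
      then show "(xpt M (a + m / 2), ygauss M gx (b + \<sigma> / 4) \<mu>) \<in> cell M (a + m / 2) (b + \<sigma> / 2)"
        "(xgauss M gx (a + m / 4) \<mu>, ypt M (b + \<sigma> / 2)) \<in> cell M (a + m / 2) (b + \<sigma> / 2)"
        using ms mesh unfolding cell_def xgauss_def ygauss_def xpt_def ypt_def uw[symmetric]
        by (auto simp: algebra_simps)
    qed
    show "X m \<sigma> \<mu> = q m \<sigma> m (gx \<mu>)"
      unfolding X_def P(1)[OF ms x] q_def using ms by (auto simp: xpt_def ygauss_def algebra_simps)
    moreover show "Y m \<sigma> \<mu> = q m \<sigma> (gx \<mu>) \<sigma>"
      unfolding Y_def P(1)[OF ms y] q_def using ms by (auto simp: ypt_def xgauss_def algebra_simps)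
    moreover have "q m \<sigma> m (gx \<mu>) \<in> G" "q m \<sigma> (gx \<mu>) \<sigma> \<in> G"
      using ms \<mu> gw(2,3)[OF \<mu>] by (intro qG; force)+
    ultimately show "X m \<sigma> \<mu> \<in> G" "Y m \<sigma> \<mu> \<in> G" by simp_all
  qed

  \<comment> \<open>Strictness comes from discarding the positive values on the two inner sides of
    the quarter.\<close>
  have K_lower: "wbar * (\<Sum>\<mu>=1..k+1. gw \<mu> * (\<alpha> * A (X m \<sigma> \<mu>) + \<beta> * A (Y m \<sigma> \<mu>))) < K m \<sigma>"
    if ms: "m \<in> {-1, 1}" "\<sigma> \<in> {-1, 1}" for m \<sigma>
  proof -
    have "(\<Sum>s=1..S. wt s * A (q m \<sigma> (xt s) (yt s))) \<ge> 0"
      using wt ms by (intro sum_nonneg mult_nonneg_nonneg less_imp_le[OF Apos] qG) auto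
    moreover have "(\<Sum>\<mu>=1..k+1. gw \<mu> * (\<alpha> * A (X m \<sigma> \<mu>) + \<beta> * A (Y m \<sigma> \<mu>)))
      < (\<Sum>\<mu>=1..k+1. gw \<mu> * (\<alpha> * (A (q m \<sigma> (-1) (gx \<mu>)) + A (q m \<sigma> 1 (gx \<mu>)))
          + \<beta> * (A (q m \<sigma> (gx \<mu>) (-1)) + A (q m \<sigma> (gx \<mu>) 1))))"
    proof (intro sum_strict_mono mult_strict_left_mono add_strict_mono)
      fix \<mu> assume \<mu>: "\<mu> \<in> ?K"
      have G: "A (q m \<sigma> s (gx \<mu>)) > 0" "A (q m \<sigma> (gx \<mu>) s) > 0" if "s \<in> {-1, 1}" for s
        using that gw(2,3)[OF \<mu>] \<mu> by (intro Apos qG[OF ms]; force)+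
      show "A (X m \<sigma> \<mu>) < A (q m \<sigma> (-1) (gx \<mu>)) + A (q m \<sigma> 1 (gx \<mu>))"
        "A (Y m \<sigma> \<mu>) < A (q m \<sigma> (gx \<mu>) (-1)) + A (q m \<sigma> (gx \<mu>) 1)"
        unfolding XY(1,2)[OF ms \<mu>] using ms G[of 1] G[of "-1"] by auto
    qed (use ab gw in auto)
    moreover have "0 \<le> r \<Longrightarrow> s < t \<Longrightarrow> wbar * s < wbar * t + r" for r s t
      using mult_strict_left_mono[OF _ wbar, of s t] by linarith
    ultimately show ?thesis unfolding K_def by blast
  qed

  define SX where "SX = (\<Sum>\<mu>\<in>?K. gw \<mu> * (A (X 1 1 \<mu>) + A (X 1 (-1) \<mu>) + A (X (-1) 1 \<mu>) + A (X (-1) (-1) \<mu>)))"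
  define SY where "SY = (\<Sum>\<mu>\<in>?K. gw \<mu> * (A (Y 1 1 \<mu>) + A (Y 1 (-1) \<mu>) + A (Y (-1) 1 \<mu>) + A (Y (-1) (-1) \<mu>)))"
  define f where "f = (\<lambda>i Z. flux e i Z \<bullet> n + \<gamma> i - \<kappa> * magnetic Z $ i)"
  define DX where "DX = (\<Sum>\<mu>\<in>?K. gw \<mu> * (f 1 (X 1 1 \<mu>) + f 1 (X 1 (-1) \<mu>) - f 1 (X (-1) 1 \<mu>) - f 1 (X (-1) (-1) \<mu>)))"
  define DY where "DY = (\<Sum>\<mu>\<in>?K. gw \<mu> * (f 2 (Y 1 1 \<mu>) - f 2 (Y 1 (-1) \<mu>) + f 2 (Y (-1) 1 \<mu>) - f 2 (Y (-1) (-1) \<mu>)))"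
  have f: "f i Z \<le> A Z" "- f i Z \<le> A Z" if "Z \<in> G" for i Z
    using fl[OF that, of 1 i] fl[OF that, of "-1" i] by (auto simp: f_def A_def)
  have "DX \<le> SX" unfolding DX_def SX_def
  proof (intro sum_mono mult_left_mono)
    fix \<mu> assume "\<mu> \<in> ?K"
    then show "f 1 (X 1 1 \<mu>) + f 1 (X 1 (-1) \<mu>) - f 1 (X (-1) 1 \<mu>) - f 1 (X (-1) (-1) \<mu>)
      \<le> A (X 1 1 \<mu>) + A (X 1 (-1) \<mu>) + A (X (-1) 1 \<mu>) + A (X (-1) (-1) \<mu>)"
      using f[OF XY(3)[of 1 1 \<mu>], of 1] f[OF XY(3)[of 1 "-1" \<mu>], of 1]
        f[OF XY(3)[of "-1" 1 \<mu>], of 1] f[OF XY(3)[of "-1" "-1" \<mu>], of 1] by simp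
  qed (use gw in \<open>auto intro: less_imp_le\<close>)
  have "DY \<le> SY" unfolding DY_def SY_def
  proof (intro sum_mono mult_left_mono)
    fix \<mu> assume "\<mu> \<in> ?K"
    then show "f 2 (Y 1 1 \<mu>) - f 2 (Y 1 (-1) \<mu>) + f 2 (Y (-1) 1 \<mu>) - f 2 (Y (-1) (-1) \<mu>)
      \<le> A (Y 1 1 \<mu>) + A (Y 1 (-1) \<mu>) + A (Y (-1) 1 \<mu>) + A (Y (-1) (-1) \<mu>)"
      using f[OF XY(4)[of 1 1 \<mu>], of 2] f[OF XY(4)[of 1 "-1" \<mu>], of 2]
        f[OF XY(4)[of "-1" 1 \<mu>], of 2] f[OF XY(4)[of "-1" "-1" \<mu>], of 2] by simp
  qed (use gw in \<open>auto intro: less_imp_le\<close>)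
  have S0: "SX \<ge> 0" "SY \<ge> 0" unfolding SX_def SY_def
    by (intro sum_nonneg mult_nonneg_nonneg add_nonneg_nonneg less_imp_le[OF Apos] less_imp_le[OF gw(1)]
        XY(3,4); simp)+

  have "wbar * (\<alpha> * SX + \<beta> * SY) < 4 * A (cell_avg M V a b)"
  proof -
    have "wbar * (\<alpha> * SX + \<beta> * SY) = (\<Sum>m\<in>{-1, 1}. \<Sum>\<sigma>\<in>{-1, 1}.
        wbar * (\<Sum>\<mu>\<in>?K. gw \<mu> * (\<alpha> * A (X m \<sigma> \<mu>) + \<beta> * A (Y m \<sigma> \<mu>))))"
      unfolding SX_def SY_def
      by (simp add: sum.distrib sum_distrib_left algebra_simps)
    also have "\<dots> < 4 * A (cell_avg M V a b)"
      using K_lower[of 1 1] K_lower[of 1 "-1"] K_lower[of "-1" 1] K_lower[of "-1" "-1"]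
      unfolding avgV by simp
    finally show ?thesis .
  qed
  then have "\<theta> * (wbar * (\<alpha> * SX + \<beta> * SY)) < \<theta> * (4 * A (cell_avg M V a b))"
    using theta by (intro mult_strict_left_mono)
  moreover have "2 * (dt / dx M) * DX + 2 * (dt / dy M) * DY \<le> \<theta> * (wbar * (\<alpha> * SX + \<beta> * SY))"
  proof -
    \<comment> \<open>A value in \<open>X\<close> has weight
      \<open>wbar * gw \<mu> * \<alpha> / 4\<close> in the average of \<open>V\<close> and
      \<open>dt / (2 * dx M) * gw \<mu>\<close> in the flux sum. As
      \<open>dt / dx M = dt * l * \<alpha>\<close>, and likewise for \<open>Y\<close> with
      \<open>\<beta>\<close>, the CFL condition compares these weights after the first is multiplied
      by \<open>\<theta>\<close>.\<close>
    have w: "2 * (dt * l) \<le> \<theta> * wbar" using cfl(2) unfolding l_def[symmetric] by simp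
    have "2 * (dt / dx M) * DX + 2 * (dt / dy M) * DY \<le> 2 * (dt / dx M) * SX + 2 * (dt / dy M) * SY"
      using dt mesh \<open>DX \<le> SX\<close> \<open>DY \<le> SY\<close> by (intro add_mono mult_left_mono) auto
    also have "\<dots> = 2 * (dt * l) * (\<alpha> * SX + \<beta> * SY)"
      using l by (simp add: \<alpha>_def \<beta>_def distrib_left)
    also have "\<dots> \<le> \<theta> * wbar * (\<alpha> * SX + \<beta> * SY)"
      using w S0 ab by (intro mult_right_mono) auto
    finally show ?thesis by (simp only: mult.assoc)
  qed
  moreover have "dt / (2 * dx M) * DX = 2 * (dt / dx M) * DX / 4" "dt / (2 * dy M) * DY = 2 * (dt / dy M) * DY / 4"
    by simp_all
  moreover have "r < \<theta> * (4 * s) \<Longrightarrow> p + q \<le> r \<Longrightarrow> p' = p / 4 \<Longrightarrow> q' = q / 4 \<Longrightarrow> p' + q' < \<theta> * s"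
    for p q p' q' r s :: real
    by simp
  ultimately have main: "dt / (2 * dx M) * DX + dt / (2 * dy M) * DY < \<theta> * A (cell_avg M V a b)"
    by blast
  have "(1 - \<theta>) * A (cell_avg M U a b) \<ge> 0" using theta avgU by (simp add: A_def)
  \<comment> \<open>As \<open>\<theta> = dt / \<tau>\<close>, the relaxation term makes the update a
    convex combination of the two averages, minus the fluxes; \<open>c\<close> splits
    accordingly.\<close>
  moreover have "updated_avg e M (k + 1) gx gw \<tau> dt U V a b \<bullet> n + c
      + dt * \<kappa> * discrete_div M (k + 1) gx gw V a b
    = (1 - \<theta>) * A (cell_avg M U a b) + \<theta> * A (cell_avg M V a b)
      - (dt / (2 * dx M) * DX + dt / (2 * dy M) * DY)"
  proof -
    define FX where "FX = (\<Sum>\<mu>\<in>?K. gw \<mu> * (flux e 1 (X 1 1 \<mu>) \<bullet> n + flux e 1 (X 1 (-1) \<mu>) \<bullet> n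
      - flux e 1 (X (-1) 1 \<mu>) \<bullet> n - flux e 1 (X (-1) (-1) \<mu>) \<bullet> n))"
    define FY where "FY = (\<Sum>\<mu>\<in>?K. gw \<mu> * (flux e 2 (Y 1 1 \<mu>) \<bullet> n - flux e 2 (Y 1 (-1) \<mu>) \<bullet> n
      + flux e 2 (Y (-1) 1 \<mu>) \<bullet> n - flux e 2 (Y (-1) (-1) \<mu>) \<bullet> n))"
    define BX where "BX = (\<Sum>\<mu>\<in>?K. gw \<mu> * (magnetic (X 1 1 \<mu>) $ 1 + magnetic (X 1 (-1) \<mu>) $ 1
      - magnetic (X (-1) 1 \<mu>) $ 1 - magnetic (X (-1) (-1) \<mu>) $ 1))"
    define BY where "BY = (\<Sum>\<mu>\<in>?K. gw \<mu> * (magnetic (Y 1 1 \<mu>) $ 2 - magnetic (Y 1 (-1) \<mu>) $ 2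
      + magnetic (Y (-1) 1 \<mu>) $ 2 - magnetic (Y (-1) (-1) \<mu>) $ 2))"
    \<comment> \<open>Two terms of either sign occur, so \<open>\<gamma>\<close> cancels, while the
      field corrections survive as \<open>\<kappa>\<close> times the sums that form the discrete
      divergence.\<close>
    have D: "DX = FX - \<kappa> * BX" "DY = FY - \<kappa> * BY"
      unfolding DX_def DY_def FX_def FY_def BX_def BY_def f_def sum_distrib_left sum_subtractf[symmetric]
      by (intro sum.cong refl; simp add: algebra_simps)+
    have op: "cell_op e M (k + 1) gx gw \<tau> U V a b \<bullet> n
      = (cell_avg M V a b \<bullet> n - cell_avg M U a b \<bullet> n) / \<tau> - FX / (2 * dx M) - FY / (2 * dy M)"
    proof -
      define TX where "TX = (\<Sum>m\<in>{-1, 1}. \<Sum>\<mu>\<in>?K. (gw \<mu> / 2) *\<^sub>R (flux e 1 (X 1 m \<mu>) - flux e 1 (X (-1) m \<mu>)))"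
      define TY where "TY = (\<Sum>m\<in>{-1, 1}. \<Sum>\<mu>\<in>?K. (gw \<mu> / 2) *\<^sub>R (flux e 2 (Y m 1 \<mu>) - flux e 2 (Y m (-1) \<mu>)))"
      have half: "TX \<bullet> n = FX / 2" "TY \<bullet> n = FY / 2"
        unfolding TX_def TY_def FX_def FY_def inner_sum_left sum_divide_distrib
        by (simp_all add: sum.distrib[symmetric] inner_simps algebra_simps add_divide_distrib diff_divide_distrib)
      have "cell_op e M (k + 1) gx gw \<tau> U V a b
          = (1 / \<tau>) *\<^sub>R (cell_avg M V a b - cell_avg M U a b) - (1 / dx M) *\<^sub>R TX - (1 / dy M) *\<^sub>R TY"
        by (simp add: cell_op_def TX_def TY_def X_def Y_def)
      then show ?thesis by (simp only: inner_diff_left inner_scaleR_left half) simp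
    qed
    have div: "discrete_div M (k + 1) gx gw V a b = BX / (2 * dx M) + BY / (2 * dy M)"
      unfolding discrete_div_def BX_def BY_def X_def Y_def sum_divide_distrib sum.distrib[symmetric]
      by (simp add: sum.distrib[symmetric] algebra_simps add_divide_distrib diff_divide_distrib)
    show ?thesis
      unfolding updated_avg_def inner_add_left inner_scaleR_left op div D A_def theta(1)
      by (simp add: algebra_simps diff_divide_distrib)
  qed
  ultimately show ?thesis using main by linarith
qed

section \<open>Application to both meshes\<close>

theorem theorem4p2:
  fixes e :: "real \<Rightarrow> real \<Rightarrow> real" and M :: mesh and k :: nat
    and gx gw :: "nat \<Rightarrow> real"
    and wbar :: real and S :: nat and wt xt yt :: "nat \<Rightarrow> real"
    and UI UJ :: "real \<times> real \<Rightarrow> state"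
    and dt \<tau> \<theta> :: real
  assumes eos: "equation_of_state e"
    and mesh: "dx M > 0" "dy M > 0"
    and gauss: "gauss_rule (k + 1) gx gw"
    and UI: "UI \<in> dg_space k (primal_cells M)"
    and UJ: "UJ \<in> dg_space k (dual_cells M)"
    and avgI: "\<And>i j :: int. cell_avg M UI (of_int i) (of_int j) \<in> admissible e"
    and avgJ: "\<And>i j :: int. cell_avg M UJ (of_int i + 1/2) (of_int j + 1/2) \<in> admissible e"
    and cad: "cad k gx gw (1 / dx M) (1 / dy M) wbar S wt xt yt"
    and nodes: "\<And>(i :: int) (j :: int) (m :: real) (\<sigma> :: real) z.
        m \<in> {-1, 1} \<Longrightarrow> \<sigma> \<in> {-1, 1} \<Longrightarrow>
        z \<in> quarter_nodes M (k + 1) gx S xt yt (of_int i + m/4) (of_int j + \<sigma>/4) \<Longrightarrow>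
        quarter_trace M (of_int i + m/4) (of_int j + \<sigma>/4) UI z \<in> admissible e \<and>
        quarter_trace M (of_int i + m/4) (of_int j + \<sigma>/4) UJ z \<in> admissible e"
    and tau: "\<tau> > 0"
    and theta: "\<theta> = dt / \<tau>" "0 < \<theta>" "\<theta> \<le> 1"
    and cfl: "0 < dt * (1 / dx M + 1 / dy M)" "dt * (1 / dx M + 1 / dy M) \<le> \<theta> * wbar / 2"
  shows
    "(\<forall>i j :: int.
        updated_avg e M (k + 1) gx gw \<tau> dt UI UJ (of_int i) (of_int j) \<bullet> n_one > 0 \<and>
        updated_avg e M (k + 1) gx gw \<tau> dt UJ UI (of_int i + 1/2) (of_int j + 1/2) \<bullet> n_one > 0 \<and>
        (\<forall>v B :: real^3. norm v < 1 \<longrightarrow>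
          updated_avg e M (k + 1) gx gw \<tau> dt UI UJ (of_int i) (of_int j) \<bullet> n_star v B
              + mag_pressure v B
            > - dt * (v \<bullet> B) * discrete_div M (k + 1) gx gw UJ (of_int i) (of_int j) \<and>
          updated_avg e M (k + 1) gx gw \<tau> dt UJ UI (of_int i + 1/2) (of_int j + 1/2) \<bullet> n_star v B
              + mag_pressure v B
            > - dt * (v \<bullet> B) * discrete_div M (k + 1) gx gw UI (of_int i + 1/2) (of_int j + 1/2)))
     \<and>
     ((\<forall>\<rho>>0. ((\<lambda>p. e p \<rho>) \<longlongrightarrow> 0) (at_right 0)) \<longrightarrow>
      (\<forall>i j :: int.
        (discrete_div M (k + 1) gx gw UJ (of_int i) (of_int j) = 0 \<longrightarrow>
          updated_avg e M (k + 1) gx gw \<tau> dt UI UJ (of_int i) (of_int j) \<in> admissible e) \<and>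
        (discrete_div M (k + 1) gx gw UI (of_int i + 1/2) (of_int j + 1/2) = 0 \<longrightarrow>
          updated_avg e M (k + 1) gx gw \<tau> dt UJ UI (of_int i + 1/2) (of_int j + 1/2) \<in> admissible e)))"
proof -
  have dual: "cell M (of_int i + m / 2) (of_int j + \<sigma> / 2) \<in> dual_cells M"
    if "m \<in> {-1, 1}" "\<sigma> \<in> {-1, 1}" for i j :: int and m \<sigma> :: real
  proof -
    define i' where "i' = (if m = 1 then i else i - 1)"
    define j' where "j' = (if \<sigma> = 1 then j else j - 1)"
    have "of_int i + m / 2 = of_int i' + 1 / 2" "of_int j + \<sigma> / 2 = of_int j' + 1 / 2"
      using that by (auto simp: i'_def j'_def)
    then show ?thesis unfolding dual_cells_def by auto
  qed
  have primal: "cell M (of_int i + 1 / 2 + m / 2) (of_int j + 1 / 2 + \<sigma> / 2) \<in> primal_cells M"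
    if "m \<in> {-1, 1}" "\<sigma> \<in> {-1, 1}" for i j :: int and m \<sigma> :: real
  proof -
    define i' where "i' = (if m = 1 then i + 1 else i)"
    define j' where "j' = (if \<sigma> = 1 then j + 1 else j)"
    have "of_int i + 1 / 2 + m / 2 = of_int i'" "of_int j + 1 / 2 + \<sigma> / 2 = of_int j'"
      using that by (auto simp: i'_def j'_def)
    then show ?thesis unfolding primal_cells_def by auto
  qed
  \<comment> \<open>A quarter cell of a dual cell is also one of a neighbouring primal cell, with
    the opposite offset: \<open>i + 1/2 + m/4 = i' - m/4\<close>. The node hypothesis is indexed by
    primal cells.\<close>
  have nodesI: "quarter_trace M (of_int i + 1 / 2 + m / 4) (of_int j + 1 / 2 + \<sigma> / 4) UI z \<in> admissible e"
    if ms: "m \<in> {-1, 1}" "\<sigma> \<in> {-1, 1}"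
      and z: "z \<in> quarter_nodes M (k + 1) gx S xt yt (of_int i + 1 / 2 + m / 4) (of_int j + 1 / 2 + \<sigma> / 4)"
    for i j :: int and m \<sigma> :: real and z
  proof -
    define i' where "i' = (if m = 1 then i + 1 else i)"
    define j' where "j' = (if \<sigma> = 1 then j + 1 else j)"
    have "of_int i + 1 / 2 + m / 4 = of_int i' + (- m) / 4" "of_int j + 1 / 2 + \<sigma> / 4 = of_int j' + (- \<sigma>) / 4"
      using that by (auto simp: i'_def j'_def)
    note eq = this
    have "- m \<in> {-1, 1}" "- \<sigma> \<in> {-1, 1}" using ms by auto
    from nodes[OF this z[unfolded eq]] show ?thesis unfolding eq by (rule conjunct1)
  qed
  have I: "updated_avg e M (k + 1) gx gw \<tau> dt UI UJ (of_int i) (of_int j) \<bullet> n + c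
      > - dt * \<kappa> * discrete_div M (k + 1) gx gw UJ (of_int i) (of_int j)"
    and J: "updated_avg e M (k + 1) gx gw \<tau> dt UJ UI (of_int i + 1/2) (of_int j + 1/2) \<bullet> n + c
      > - dt * \<kappa> * discrete_div M (k + 1) gx gw UI (of_int i + 1/2) (of_int j + 1/2)"
    if pos: "\<And>X. X \<in> admissible e \<Longrightarrow> X \<bullet> n + c > 0"
      and fl: "\<And>X s i. X \<in> admissible e \<Longrightarrow> \<bar>s\<bar> = 1 \<Longrightarrow>
        X \<bullet> n + c - s * (flux e i X \<bullet> n + \<gamma> i - \<kappa> * magnetic X $ i) \<ge> 0"
    for n c \<kappa> \<gamma> and i j :: int
    by (rule updated_avg_bound[OF mesh gauss UJ dual cad conjunct2[OF nodes] theta cfl pos fl pos[OF avgI]]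
        updated_avg_bound[OF mesh gauss UI primal cad nodesI theta cfl pos fl pos[OF avgJ]]; assumption)+
  \<comment> \<open>For \<open>n_one\<close> all corrections are zero, so no divergence term
    appears.\<close>
  have D: "updated_avg e M (k + 1) gx gw \<tau> dt UI UJ (of_int i) (of_int j) \<bullet> n_one > 0"
    "updated_avg e M (k + 1) gx gw \<tau> dt UJ UI (of_int i + 1/2) (of_int j + 1/2) \<bullet> n_one > 0"
    for i j :: int
    using I[of n_one 0 "\<lambda>_. 0" 0 i j] J[of n_one 0 "\<lambda>_. 0" 0 i j] by (simp_all add: n_one_pos n_one_flux_bound)
  have N: "updated_avg e M (k + 1) gx gw \<tau> dt UI UJ (of_int i) (of_int j) \<bullet> n_star v B + mag_pressure v B
      > - dt * (v \<bullet> B) * discrete_div M (k + 1) gx gw UJ (of_int i) (of_int j)"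
    "updated_avg e M (k + 1) gx gw \<tau> dt UJ UI (of_int i + 1/2) (of_int j + 1/2) \<bullet> n_star v B + mag_pressure v B
      > - dt * (v \<bullet> B) * discrete_div M (k + 1) gx gw UI (of_int i + 1/2) (of_int j + 1/2)"
    if v: "norm v < 1" for v B :: "real^3" and i j :: int
  proof -
    have "X \<bullet> n_star v B + mag_pressure v B
        - s * (flux e i X \<bullet> n_star v B + v $ i * mag_pressure v B - (v \<bullet> B) * magnetic X $ i) \<ge> 0"
      if "X \<in> admissible e" "\<bar>s\<bar> = 1" for X s i
      using n_star_flux_bound[OF eos that(1) v that(2)] by (simp add: mult.commute)
    note * = n_star_pos[OF eos _ v] this
    show "updated_avg e M (k + 1) gx gw \<tau> dt UI UJ (of_int i) (of_int j) \<bullet> n_star v B + mag_pressure v B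
      > - dt * (v \<bullet> B) * discrete_div M (k + 1) gx gw UJ (of_int i) (of_int j)"
      by (rule I[OF *])
    show "updated_avg e M (k + 1) gx gw \<tau> dt UJ UI (of_int i + 1/2) (of_int j + 1/2) \<bullet> n_star v B + mag_pressure v B
      > - dt * (v \<bullet> B) * discrete_div M (k + 1) gx gw UI (of_int i + 1/2) (of_int j + 1/2)"
      by (rule J[OF *])
  qed
  show ?thesis
  proof (intro conjI allI impI)
    fix i j :: int
    assume lim: "\<forall>\<rho>>0. ((\<lambda>p. e p \<rho>) \<longlongrightarrow> 0) (at_right 0)"
    show "updated_avg e M (k + 1) gx gw \<tau> dt UI UJ (of_int i) (of_int j) \<in> admissible e"
      if "discrete_div M (k + 1) gx gw UJ (of_int i) (of_int j) = 0"
      using lim N(1)[where i = i and j = j] unfolding that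
      by (intro admissible_if_n_star_pos[OF eos _ D(1)]) simp_all
    show "updated_avg e M (k + 1) gx gw \<tau> dt UJ UI (of_int i + 1/2) (of_int j + 1/2) \<in> admissible e"
      if "discrete_div M (k + 1) gx gw UI (of_int i + 1/2) (of_int j + 1/2) = 0"
      using lim N(2)[where i = i and j = j] unfolding that
      by (intro admissible_if_n_star_pos[OF eos _ D(2)]) simp_all
  qed (use D N in auto)
qed

end
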